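(* Let $\omega\subset\mathbb{R}^2$ and $\psi_A\in H^3(\omega;\mathbb{R}^3)$ be as in the context. There is a real-valued function $C_A$ on $\omega$, depending only on derivatives of $\psi_A$ (in particular, not depending on $\psi_B$), such that the following holds. Let $\psi_B=(\psi_B^m)_{m=1,2,3}\in H^2(\omega;\mathbb{R}^3)$ satisfy $(\nabla\psi_B)^\top\nabla\psi_B=(\nabla\psi_A)^\top\nabla\psi_A$ almost everywhere in $\omega$. Then, almost everywhere in $\omega$, $$\operatorname{tr}\left(S^{\mathrm{rel}}_{\psi_B}S^{\mathrm{rel}}_{\psi_B}\right)=\left|g_A^{-\frac12}(II_B-II_A)g_A^{-\frac12}\right|^2=B[\psi_B],$$ where $$B[\psi_B]:=\sum_{m=1}^{3}\left|g_A^{-\frac12}D^2\psi_B^m\,g_A^{-\frac12}\right|^2-2\,II_B:\left(g_A^{-1}II_A\,g_A^{-1}\right)+C_A .$$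
   Context: $\omega\subset\mathbb{R}^2$ is a bounded, connected Lipschitz domain. $\psi_A\in H^3(\omega;\mathbb{R}^3)$ is an injective regular parametrization: using $H^3(\omega)\hookrightarrow C^1(\overline{\omega})$, the matrix $\nabla\psi_A(x)\in\mathbb{R}^{3\times2}$ has rank $2$ for all $x\in\overline\omega$, so that $g_A:=(\nabla\psi_A)^\top\nabla\psi_A$ is symmetric positive definite with $g_A$, $g_A^{-1}$, $g_A^{-1/2}$ uniformly bounded; $g_A^{-1/2}$ is the symmetric positive definite square root of $g_A^{-1}$. For a parametrization $\psi$, the unit normal is $n[\psi]=\frac{\partial_1\psi\times\partial_2\psi}{|\partial_1\psi\times\partial_2\psi|}$; write $n_A=n[\psi_A]$, $n_B=n[\psi_B]$. The notation $D^2\psi\cdot n$ means the $2\times2$ matrix $(\partial_i\partial_j\psi\cdot n)_{i,j=1,2}$. The second fundamental forms are $II_A=-D^2\psi_A\cdot n_A$ and $II_B=-D^2\psi_B\cdot n_B$. The relative shape operator is $$S^{\mathrm{rel}}_{\psi_B}:=g_A^{-1}(II_A-II_B)=g_A^{-1}\left(D^2\psi_B\cdot n_B-D^2\psi_A\cdot n_A\right).$$ $D^2\psi_B^m$ is the $2\times 2$ Hessian of the component $\psi_B^m$, $X:Y=\sum_{i,j}X_{ij}Y_{ij}$, and $|X|^2=X:X$ is the squared Frobenius norm. *)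

theory Defs
  imports "HOL-Analysis.Analysis"
begin

section \<open>Lipschitz domains in the plane\<close>

text \<open>
  Near every boundary point, after an orthogonal change of coordinates, the set is the strict
  epigraph of a Lipschitz function of one variable.
\<close>

definition lipschitz_boundary :: "(real^2) set \<Rightarrow> bool" where
  "lipschitz_boundary \<omega> \<longleftrightarrow>
     (\<forall>p\<in>frontier \<omega>. \<exists>r>0. \<exists>Q :: real^2 \<Rightarrow> real^2. \<exists>\<gamma>::real \<Rightarrow> real. \<exists>L.
        orthogonal_transformation Q \<and> L-lipschitz_on UNIV \<gamma> \<and>
        \<omega> \<inter> ball p r = {x \<in> ball p r. \<gamma> (Q x $ 1) < Q x $ 2})"

definition bounded_connected_lipschitz_domain :: "(real^2) set \<Rightarrow> bool" where
  "bounded_connected_lipschitz_domain \<omega> \<longleftrightarrow>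
     open \<omega> \<and> \<omega> \<noteq> {} \<and> bounded \<omega> \<and> connected \<omega> \<and> lipschitz_boundary \<omega>"

section \<open>Weak derivatives and Sobolev spaces\<close>

text \<open>Classical iterated partial derivatives; the multi-index is given as a list of directions.\<close>

primrec partials :: "'n::finite list \<Rightarrow> (real^'n \<Rightarrow> real) \<Rightarrow> real^'n \<Rightarrow> real" where
  "partials [] f = f"
| "partials (i # is) f = (\<lambda>x. frechet_derivative (partials is f) (at x) (axis i 1))"

text \<open>
  If all iterated partial derivatives are (totally) differentiable, they all exist and are
  continuous, so this is \<open>C\<^sup>\<infinity>\<close> on the whole space.
\<close>

definition smooth :: "(real^'n::finite \<Rightarrow> real) \<Rightarrow> bool" where
  "smooth f \<longleftrightarrow> (\<forall>is. partials is f differentiable_on UNIV)"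

definition test_function :: "(real^'n::finite) set \<Rightarrow> (real^'n \<Rightarrow> real) \<Rightarrow> bool" where
  "test_function \<omega> \<phi> \<longleftrightarrow>
     smooth \<phi> \<and> compact (closure {x. \<phi> x \<noteq> 0}) \<and> closure {x. \<phi> x \<noteq> 0} \<subseteq> \<omega>"

definition locally_integrable :: "(real^'n::finite) set \<Rightarrow> (real^'n \<Rightarrow> real) \<Rightarrow> bool" where
  "locally_integrable \<omega> u \<longleftrightarrow> (\<forall>K. compact K \<and> K \<subseteq> \<omega> \<longrightarrow> integrable (lebesgue_on K) u)"

definition has_weak_derivative ::
  "(real^'n::finite) set \<Rightarrow> 'n list \<Rightarrow> (real^'n \<Rightarrow> real) \<Rightarrow> (real^'n \<Rightarrow> real) \<Rightarrow> bool" where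
  "has_weak_derivative \<omega> is u v \<longleftrightarrow>
     locally_integrable \<omega> u \<and> locally_integrable \<omega> v \<and>
     (\<forall>\<phi>. test_function \<omega> \<phi> \<longrightarrow>
        integral\<^sup>L (lebesgue_on \<omega>) (\<lambda>x. u x * partials is \<phi> x)
          = (-1) ^ length is * integral\<^sup>L (lebesgue_on \<omega>) (\<lambda>x. v x * \<phi> x))"

definition square_integrable_on :: "(real^'n::finite) set \<Rightarrow> (real^'n \<Rightarrow> real) \<Rightarrow> bool" where
  "square_integrable_on \<omega> u \<longleftrightarrow>
     u \<in> borel_measurable (lebesgue_on \<omega>) \<and> integrable (lebesgue_on \<omega>) (\<lambda>x. (u x)\<^sup>2)"

text \<open>
  \<open>H\<^sup>k(\<omega>)\<close> and its vector-valued version. The empty list in the definition yields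
  \<open>u \<in> L\<^sup>2(\<omega>)\<close>, up to a null set; measurability of \<open>u\<close> itself follows as Lebesgue measure
  is complete.
\<close>

definition sobolev_H :: "nat \<Rightarrow> (real^'n::finite) set \<Rightarrow> (real^'n \<Rightarrow> real) \<Rightarrow> bool" where
  "sobolev_H k \<omega> u \<longleftrightarrow>
     (\<forall>is. length is \<le> k \<longrightarrow> (\<exists>v. has_weak_derivative \<omega> is u v \<and> square_integrable_on \<omega> v))"

definition sobolev_H_vec :: "nat \<Rightarrow> (real^'n::finite) set \<Rightarrow> (real^'n \<Rightarrow> real^'m::finite) \<Rightarrow> bool" where
  "sobolev_H_vec k \<omega> \<psi> \<longleftrightarrow> (\<forall>m. sobolev_H k \<omega> (\<lambda>x. \<psi> x $ m))"

text \<open>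
  A chosen representative of the weak derivative, which is unique only up to null sets (and
  arbitrary if there is no weak derivative).
\<close>

definition weak_derivative ::
  "(real^'n::finite) set \<Rightarrow> 'n list \<Rightarrow> (real^'n \<Rightarrow> real) \<Rightarrow> real^'n \<Rightarrow> real" where
  "weak_derivative \<omega> is u = (SOME v. has_weak_derivative \<omega> is u v)"

section \<open>Parametrized surfaces\<close>

definition grad :: "(real^2) set \<Rightarrow> (real^2 \<Rightarrow> real^3) \<Rightarrow> real^2 \<Rightarrow> real^2^3" where
  "grad \<omega> \<psi> x = (\<chi> m i. weak_derivative \<omega> [i] (\<lambda>y. \<psi> y $ m) x)"

text \<open>The component \<open>hess \<omega> \<psi> x $ m\<close> is the Hessian of \<open>\<psi>\<^sup>m\<close>.\<close>

definition hess :: "(real^2) set \<Rightarrow> (real^2 \<Rightarrow> real^3) \<Rightarrow> real^2 \<Rightarrow> real^2^2^3" where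
  "hess \<omega> \<psi> x = (\<chi> m i j. weak_derivative \<omega> [i, j] (\<lambda>y. \<psi> y $ m) x)"

text \<open>
  Here \<open>\<psi>\<close> is the continuous representative of its Sobolev class: \<open>\<psi>\<close> is continuously
  differentiable up to the boundary, \<open>G\<close> being the continuous extension of its classical
  Jacobian to \<open>closure \<omega>\<close>.
\<close>

definition injective_regular_parametrization :: "(real^2) set \<Rightarrow> (real^2 \<Rightarrow> real^3) \<Rightarrow> bool" where
  "injective_regular_parametrization \<omega> \<psi> \<longleftrightarrow>
     inj_on \<psi> \<omega> \<and> continuous_on (closure \<omega>) \<psi> \<and>
     (\<exists>G :: real^2 \<Rightarrow> real^2^3. continuous_on (closure \<omega>) G \<and>
        (\<forall>x\<in>\<omega>. (\<psi> has_derivative (\<lambda>h. G x *v h)) (at x)) \<and>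
        (\<forall>x\<in>closure \<omega>. rank (G x) = 2))"

definition metric_tensor :: "(real^2) set \<Rightarrow> (real^2 \<Rightarrow> real^3) \<Rightarrow> real^2 \<Rightarrow> real^2^2" where
  "metric_tensor \<omega> \<psi> x = transpose (grad \<omega> \<psi> x) ** grad \<omega> \<psi> x"

definition sym_pos_def :: "real^'n::finite^'n \<Rightarrow> bool" where
  "sym_pos_def A \<longleftrightarrow> transpose A = A \<and> (\<forall>v. v \<noteq> 0 \<longrightarrow> 0 < v \<bullet> (A *v v))"

definition spd_sqrt :: "real^'n^'n::finite \<Rightarrow> real^'n^'n" where
  "spd_sqrt A = (THE R. sym_pos_def R \<and> R ** R = A)"

definition inv_metric_tensor :: "(real^2) set \<Rightarrow> (real^2 \<Rightarrow> real^3) \<Rightarrow> real^2 \<Rightarrow> real^2^2" where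
  "inv_metric_tensor \<omega> \<psi> x = matrix_inv (metric_tensor \<omega> \<psi> x)"

definition inv_sqrt_metric :: "(real^2) set \<Rightarrow> (real^2 \<Rightarrow> real^3) \<Rightarrow> real^2 \<Rightarrow> real^2^2" where
  "inv_sqrt_metric \<omega> \<psi> x = spd_sqrt (inv_metric_tensor \<omega> \<psi> x)"

definition unit_normal :: "(real^2) set \<Rightarrow> (real^2 \<Rightarrow> real^3) \<Rightarrow> real^2 \<Rightarrow> real^3" where
  "unit_normal \<omega> \<psi> x =
     (let c = cross3 (column 1 (grad \<omega> \<psi> x)) (column 2 (grad \<omega> \<psi> x)) in c /\<^sub>R norm c)"

definition hess_dot_normal :: "(real^2) set \<Rightarrow> (real^2 \<Rightarrow> real^3) \<Rightarrow> real^2 \<Rightarrow> real^2^2" where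
  "hess_dot_normal \<omega> \<psi> x = (\<chi> i j. (\<chi> m. hess \<omega> \<psi> x $ m $ i $ j) \<bullet> unit_normal \<omega> \<psi> x)"

definition second_form :: "(real^2) set \<Rightarrow> (real^2 \<Rightarrow> real^3) \<Rightarrow> real^2 \<Rightarrow> real^2^2" where
  "second_form \<omega> \<psi> x = - hess_dot_normal \<omega> \<psi> x"

definition rel_shape_operator ::
  "(real^2) set \<Rightarrow> (real^2 \<Rightarrow> real^3) \<Rightarrow> (real^2 \<Rightarrow> real^3) \<Rightarrow> real^2 \<Rightarrow> real^2^2" where
  "rel_shape_operator \<omega> \<psi>A \<psi>B x =
     inv_metric_tensor \<omega> \<psi>A x ** (second_form \<omega> \<psi>A x - second_form \<omega> \<psi>B x)"

text \<open>
  On \<open>real^2^2\<close> the library's inner product is \<open>X : Y = \<Sum>\<^sub>i\<^sub>j X\<^sub>i\<^sub>j Y\<^sub>i\<^sub>j\<close> and its norm is the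
  Frobenius norm.
\<close>

definition B_functional ::
  "(real^2) set \<Rightarrow> (real^2 \<Rightarrow> real^3) \<Rightarrow> (real^2 \<Rightarrow> real) \<Rightarrow> (real^2 \<Rightarrow> real^3) \<Rightarrow> real^2 \<Rightarrow> real" where
  "B_functional \<omega> \<psi>A C \<psi>B x =
     (\<Sum>m\<in>UNIV. (norm (inv_sqrt_metric \<omega> \<psi>A x ** (hess \<omega> \<psi>B x $ m) ** inv_sqrt_metric \<omega> \<psi>A x))\<^sup>2)
     - 2 * (second_form \<omega> \<psi>B x \<bullet> (inv_metric_tensor \<omega> \<psi>A x ** second_form \<omega> \<psi>A x ** inv_metric_tensor \<omega> \<psi>A x))
     + C x"

end

theory Submission
  imports Defs
begin

text \<open>
  At a point, the claim is linear algebra. Write \<open>R\<close> for \<open>g\<^sub>A\<^sup>-\<^sup>1\<^sup>/\<^sup>2\<close>, so that \<open>R ** R\<close> is the inverse metric.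
  Cyclicity of the trace moves one factor \<open>R\<close> around and turns the trace into the squared norm of
  \<open>R ** (II\<^sub>B - II\<^sub>A) ** R\<close>. Expanding this square yields the mixed term of the functional, a term
  depending on \<open>\<psi>A\<close> only, and the squared norm of \<open>R ** II\<^sub>B ** R\<close>. The latter is the part of
  \<open>\<Sum>\<^sub>m |R ** D\<^sup>2\<psi>B\<^sup>m ** R|\<^sup>2\<close> that comes from the normal components of the second derivatives. What
  remains is the energy of the tangential components. It is a function of the metric and of the
  inner products \<open>\<partial>\<^sub>i\<partial>\<^sub>j\<psi>B \<bullet> \<partial>\<^sub>k\<psi>B\<close>, that is, of the Christoffel symbols of the first kind. These are
  derivatives of the metric, so they agree for \<open>\<psi>A\<close> and \<open>\<psi>B\<close>, and the tangential energy may be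
  computed from \<open>\<psi>A\<close> (lemma \<open>tangential_hessian_energy_eq\<close>).

  The analytic content is that, for maps in \<open>H\<^sup>2\<close>, the metric determines those inner products almost
  everywhere (lemma \<open>isometric_tangential_hessian_AE\<close>). Differentiating the metric requires the
  product rule for functions in \<open>H\<^sup>1\<close>; comparing the two results requires uniqueness of weak
  derivatives; Koszul's formula requires symmetry of the weak Hessian. All three rest on one device,
  the doubling of variables. The integral of \<open>f x * g x\<close> is replaced by the double integral of
  \<open>f x * g y\<close> against a bump in \<open>x - y\<close>. In the double integral only smooth functions have to be
  differentiated, and for the combinations of interest it vanishes for every narrow bump. As the
  bump shrinks, the diagonal is recovered, because \<open>z \<mapsto> \<integral> f x * g (x - z) dx\<close> is continuous at \<open>0\<close> when
  \<open>f\<close> and \<open>g\<close> are square integrable, or when \<open>f\<close> is integrable and \<open>g\<close> is bounded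
  (lemma \<open>diagonal_integral_zero\<close>).

  Finally, the classical Jacobian of the regular parametrization \<open>\<psi>A\<close> is also its weak gradient
  (lemma \<open>continuously_differentiable_has_weak_derivative\<close>), so the metric is positive definite almost
  everywhere and its inverse square root is the one described by the algebra.
\<close>

section \<open>Symmetric positive definite matrices and the Frobenius product\<close>

lemma matrix_inner_eq_trace:
  fixes X Y :: "real^'n^'n"
  shows "X \<bullet> Y = trace (transpose X ** Y)"
proof -
  have "trace (transpose X ** Y) = (\<Sum>i\<in>UNIV. \<Sum>k\<in>UNIV. X$k$i * Y$k$i)"
    by (simp add: trace_def matrix_matrix_mult_def transpose_def)
  also have "\<dots> = (\<Sum>k\<in>UNIV. \<Sum>i\<in>UNIV. X$k$i * Y$k$i)"
    by (rule sum.swap)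
  finally show ?thesis by (simp add: inner_vec_def)
qed

lemma trace_square_eq_norm_conjugate:
  fixes R M :: "real^'n^'n"
  assumes "transpose R = R" "transpose M = M"
  shows "trace ((R ** R ** M) ** (R ** R ** M)) = (norm (R ** M ** R))\<^sup>2"
proof -
  have "trace ((R ** R ** M) ** (R ** R ** M)) = trace (R ** (R ** M ** R ** R ** M))"
    by (simp add: matrix_mul_assoc)
  also have "\<dots> = trace ((R ** M ** R ** R ** M) ** R)"
    by (rule trace_mul_sym)
  also have "\<dots> = trace (transpose (R ** M ** R) ** (R ** M ** R))"
    using assms by (simp add: matrix_transpose_mul matrix_mul_assoc)
  finally show ?thesis by (simp add: matrix_inner_eq_trace power2_norm_eq_inner)
qed

lemma inner_conjugate_symmetric:
  fixes R M N :: "real^'n^'n"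
  assumes "transpose R = R"
  shows "(R ** M ** R) \<bullet> (R ** N ** R) = M \<bullet> ((R ** R) ** N ** (R ** R))"
proof -
  have "(R ** M ** R) \<bullet> (R ** N ** R) = trace (R ** (transpose M ** R ** R ** N ** R))"
    using assms by (simp add: matrix_inner_eq_trace matrix_transpose_mul matrix_mul_assoc)
  also have "\<dots> = trace ((transpose M ** R ** R ** N ** R) ** R)"
    by (rule trace_mul_sym)
  finally show ?thesis by (simp add: matrix_inner_eq_trace matrix_mul_assoc)
qed

lemma sym_pos_def_inverse:
  fixes A :: "real^'n^'n"
  assumes "sym_pos_def A"
  shows "sym_pos_def (matrix_inv A)"
proof -
  have sym: "transpose A = A" and pos: "\<And>v. v \<noteq> 0 \<Longrightarrow> 0 < v \<bullet> (A *v v)"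
    using assms by (auto simp: sym_pos_def_def)
  have "\<And>v. A *v v = 0 \<Longrightarrow> v = 0"
    using pos by force
  then have "invertible A"
    by (simp add: invertible_left_inverse matrix_left_invertible_ker)
  then have inv: "A ** matrix_inv A = mat 1" "matrix_inv A ** A = mat 1"
    unfolding invertible_def matrix_inv_def
    by (rule someI_ex[THEN conjunct1], rule someI_ex[THEN conjunct2])
  have symI: "transpose (matrix_inv A) = matrix_inv A"
    by (metis inv sym matrix_mul_assoc matrix_mul_lid matrix_mul_rid matrix_transpose_mul
        transpose_mat)
  have "0 < v \<bullet> (matrix_inv A *v v)" if "v \<noteq> 0" for v
  proof -
    define w where "w = matrix_inv A *v v"
    have v: "v = A *v w"
      by (simp add: w_def matrix_vector_mul_assoc inv)
    with that have "w \<noteq> 0" by auto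
    with pos[of w] show ?thesis
      by (simp add: v matrix_vector_mul_assoc inv inner_commute)
  qed
  with symI show ?thesis by (simp add: sym_pos_def_def)
qed

text \<open>
  Sylvester's criterion, which turns positive definiteness into the two inequalities needed for the
  explicit square root below.
\<close>

lemma sym_pos_def_2_iff:
  fixes A :: "real^2^2"
  shows "sym_pos_def A \<longleftrightarrow> A$1$2 = A$2$1 \<and> 0 < A$1$1 \<and> 0 < det A"
proof
  assume A: "sym_pos_def A"
  then have tr: "transpose A = A" and pos: "\<And>v. v \<noteq> 0 \<Longrightarrow> 0 < v \<bullet> (A *v v)"
    by (auto simp: sym_pos_def_def)
  have "transpose A $ 2 $ 1 = A$2$1" by (simp only: tr)
  then have sym: "A$1$2 = A$2$1" by (simp add: transpose_def)
  have a: "0 < A$1$1"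
    using pos[of "vector [1,0]"]
    by (simp add: inner_vec_def matrix_vector_mult_def sum_2 vec_eq_iff forall_2)
  have "0 < A$1$1 * det A"
    using pos[of "vector [- A$1$2, A$1$1]"] a
    by (simp add: inner_vec_def matrix_vector_mult_def sum_2 vec_eq_iff forall_2 det_2 sym
        algebra_simps)
  with a have "0 < det A"
    by (simp add: zero_less_mult_iff)
  with a sym show "A$1$2 = A$2$1 \<and> 0 < A$1$1 \<and> 0 < det A" by simp
next
  assume A: "A$1$2 = A$2$1 \<and> 0 < A$1$1 \<and> 0 < det A"
  have "0 < v \<bullet> (A *v v)" if v: "v \<noteq> 0" for v
  proof -
    \<comment> \<open>Complete the square.\<close>
    have "A$1$1 * (v \<bullet> (A *v v)) = (A$1$1 * v$1 + A$1$2 * v$2)\<^sup>2 + det A * (v$2)\<^sup>2"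
      using A by (simp add: inner_vec_def matrix_vector_mult_def sum_2 det_2 power2_eq_square
          algebra_simps)
    moreover have "0 < (A$1$1 * v$1 + A$1$2 * v$2)\<^sup>2 + det A * (v$2)\<^sup>2"
    proof (cases "v$2 = 0")
      case True
      then have "v$1 \<noteq> 0" using v by (auto simp: vec_eq_iff forall_2)
      with A True show ?thesis by simp
    next
      case False
      with A show ?thesis by (simp add: add_nonneg_pos)
    qed
    ultimately have "0 < A$1$1 * (v \<bullet> (A *v v))" by simp
    then show ?thesis
      using A zero_less_mult_pos by blast
  qed
  with A show "sym_pos_def A"
    by (simp add: sym_pos_def_def transpose_def vec_eq_iff forall_2)
qed

text \<open>
  By the Cayley--Hamilton theorem, a square root \<open>S\<close> of \<open>A\<close> satisfies
  \<open>A - trace S * S + det S = 0\<close>. Taking determinants and traces of \<open>S ** S = A\<close> expresses \<open>det S\<close> and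
  \<open>trace S\<close> through \<open>A\<close>, with signs fixed by positivity. So there is exactly one candidate.
\<close>

lemma spd_sqrt_2:
  fixes A :: "real^2^2"
  assumes A: "sym_pos_def A"
  shows "sym_pos_def (spd_sqrt A)" and "spd_sqrt A ** spd_sqrt A = A"
proof -
  define d where "d = sqrt (det A)"
  define t where "t = sqrt (trace A + 2 * d)"
  define R :: "real^2^2" where "R = (\<chi> i j. (A$i$j + (if i = j then d else 0)) / t)"
  have A': "A$2$1 = A$1$2" "0 < A$1$1" "0 < det A"
    using A by (auto simp: sym_pos_def_2_iff)
  have "0 < A$1$1 * A$2$2"
    using A' by (simp add: det_2) (smt (verit) zero_le_square)
  then have a22: "0 < A$2$2" using A' by (simp add: zero_less_mult_iff)
  have d: "0 < d" "d * d = A$1$1 * A$2$2 - A$1$2 * A$1$2"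
    using A' by (simp_all add: d_def det_2)
  have t: "0 < t" "t * t = A$1$1 + A$2$2 + 2 * d"
    using A' a22 d by (simp_all add: t_def trace_def sum_2)
  have R: "R$1$1 = (A$1$1 + d) / t" "R$1$2 = A$1$2 / t" "R$2$1 = A$1$2 / t"
    "R$2$2 = (A$2$2 + d) / t"
    by (simp_all add: R_def A')
  have Rt: "R$1$1 * t = A$1$1 + d" "R$1$2 * t = A$1$2" "R$2$1 * t = A$1$2"
    "R$2$2 * t = A$2$2 + d"
    using t(1) by (simp_all add: R)
  have sq: "R ** R = A"
  proof -
    have "(R ** R)$i$j * (t * t) = A$i$j * (t * t)" for i j
    proof -
      have "(R ** R)$i$j * (t * t) = (R$i$1 * t) * (R$1$j * t) + (R$i$2 * t) * (R$2$j * t)"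
        by (simp add: matrix_matrix_mult_def sum_2 algebra_simps)
      also have "\<dots> = A$i$j * (t * t)"
        using exhaust_2[of i] exhaust_2[of j] d(2) unfolding t(2)
        by (elim disjE; hypsubst; simp only: Rt A'; simp add: algebra_simps)
      finally show ?thesis .
    qed
    then show ?thesis using t(1) by (simp add: vec_eq_iff)
  qed
  have "det R * (t * t) = (R$1$1 * t) * (R$2$2 * t) - (R$1$2 * t) * (R$2$1 * t)"
    by (simp add: det_2 algebra_simps)
  also have "\<dots> = d * (t * t)"
    using d(2) unfolding t(2) Rt by (simp add: algebra_simps)
  finally have "det R = d"
    using t(1) by simp
  then have "sym_pos_def R"
    using A' d t by (simp add: sym_pos_def_2_iff R)
  moreover have "S = R" if S: "sym_pos_def S" "S ** S = A" for S
  proof -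
    have S': "S$2$1 = S$1$2" "0 < S$1$1" "0 < det S"
      using S by (auto simp: sym_pos_def_2_iff)
    have "0 < S$1$1 * S$2$2"
      using S' by (simp add: det_2) (smt (verit) zero_le_square)
    then have s22: "0 < S$2$2" using S' by (simp add: zero_less_mult_iff)
    have "det S * det S = det A"
      using S by (metis det_mul)
    then have dS: "det S = d"
      using S' by (metis d_def real_sqrt_mult_self abs_of_pos real_sqrt_abs2)
    have SS: "A$1$1 = S$1$1 * S$1$1 + S$1$2 * S$1$2" "A$1$2 = S$1$2 * (S$1$1 + S$2$2)"
      "A$2$2 = S$1$2 * S$1$2 + S$2$2 * S$2$2"
      by (simp_all add: S(2)[symmetric] matrix_matrix_mult_def sum_2 S' algebra_simps)
    have dd: "d = S$1$1 * S$2$2 - S$1$2 * S$1$2"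
      by (simp add: dS[symmetric] det_2 S')
    have "t * t = (S$1$1 + S$2$2) * (S$1$1 + S$2$2)"
      unfolding t(2) SS dd by (simp add: algebra_simps)
    then have tS: "t = S$1$1 + S$2$2"
      using t(1) S'(2) s22 by (metis abs_of_pos add_pos_pos real_sqrt_abs2)
    have "S$i$j * t = R$i$j * t" for i j
      using exhaust_2[of i] exhaust_2[of j]
      by (elim disjE; hypsubst; simp only: Rt; simp add: S' tS SS dd algebra_simps)
    then show ?thesis
      using t(1) by (simp add: vec_eq_iff)
  qed
  ultimately have "spd_sqrt A = R"
    unfolding spd_sqrt_def using sq by (intro the_equality) blast+
  then show "sym_pos_def (spd_sqrt A)" "spd_sqrt A ** spd_sqrt A = A"
    using \<open>sym_pos_def R\<close> sq by simp_all
qed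

section \<open>Second derivatives of isometric surfaces at a point\<close>

unbundle cross3_syntax

lemma cross_norm_eq_gram:
  fixes p q p' q' :: "real^3"
  assumes "p' \<bullet> p' = p \<bullet> p" "p' \<bullet> q' = p \<bullet> q" "q' \<bullet> q' = q \<bullet> q"
  shows "norm (p' \<times> q') = norm (p \<times> q)"
proof -
  have "(norm (p' \<times> q'))\<^sup>2 = (norm (p \<times> q))\<^sup>2"
    using norm_cross_dot[of p q] norm_cross_dot[of p' q'] assms
    by (simp add: power_mult_distrib power2_norm_eq_inner)
  then show ?thesis by simp
qed

text \<open>
  Lagrange's formula expresses \<open>w \<times> (p \<times> q)\<close>, which carries the part of \<open>w\<close> tangent to the plane of
  \<open>p\<close> and \<open>q\<close>, through \<open>w \<bullet> p\<close> and \<open>w \<bullet> q\<close>. The length of the tangential part of \<open>w\<close> is therefore a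
  function of these two numbers and of the Gram matrix of \<open>p\<close> and \<open>q\<close>.
\<close>

lemma tangential_part_from_gram:
  fixes p q w p' q' w' :: "real^3"
  assumes "p' \<bullet> p' = p \<bullet> p" "p' \<bullet> q' = p \<bullet> q" "q' \<bullet> q' = q \<bullet> q"
    and w: "w' \<bullet> p' = w \<bullet> p" "w' \<bullet> q' = w \<bullet> q"
    and c: "p \<times> q \<noteq> 0"
  shows "(norm w')\<^sup>2 - (w' \<bullet> ((p' \<times> q') /\<^sub>R norm (p' \<times> q')))\<^sup>2
       = (norm w)\<^sup>2 - (w \<bullet> ((p \<times> q) /\<^sub>R norm (p \<times> q)))\<^sup>2"
proof -
  define N where "N = norm (p \<times> q)"
  have N: "norm (p' \<times> q') = N" "N > 0"
    using cross_norm_eq_gram[OF assms(1-3)] c by (simp_all add: N_def)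
  have split: "(norm v)\<^sup>2 - (v \<bullet> ((a \<times> b) /\<^sub>R norm (a \<times> b)))\<^sup>2
      = ((v \<bullet> b)\<^sup>2 * (a \<bullet> a) - 2 * (v \<bullet> a) * (v \<bullet> b) * (a \<bullet> b) + (v \<bullet> a)\<^sup>2 * (b \<bullet> b)) / N\<^sup>2"
    if "norm (a \<times> b) = N" for v a b :: "real^3"
  proof -
    have "(norm (v \<times> (a \<times> b)))\<^sup>2 + (v \<bullet> (a \<times> b))\<^sup>2 = (norm v)\<^sup>2 * N\<^sup>2"
      by (simp add: norm_cross_dot that power_mult_distrib)
    moreover have "(norm (v \<times> (a \<times> b)))\<^sup>2
        = (v \<bullet> b)\<^sup>2 * (a \<bullet> a) - 2 * (v \<bullet> a) * (v \<bullet> b) * (a \<bullet> b) + (v \<bullet> a)\<^sup>2 * (b \<bullet> b)"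
      unfolding Lagrange power2_norm_eq_inner
      by (simp add: inner_diff_left inner_diff_right power2_eq_square inner_commute algebra_simps)
    ultimately show ?thesis
      using N(2) by (simp add: that power_mult_distrib power_divide divide_simps)
  qed
  show ?thesis
    using split[OF N(1)] split[OF N_def[symmetric]] assms by simp
qed

lemma norm_square_eq_sum_entries:
  fixes X :: "real^'n^'m"
  shows "(norm X)\<^sup>2 = (\<Sum>a\<in>UNIV. \<Sum>b\<in>UNIV. (X$a$b)\<^sup>2)"
  unfolding power2_norm_eq_inner by (simp add: inner_vec_def power2_eq_square)

definition hess_along :: "real^2^2^3 \<Rightarrow> real^3 \<Rightarrow> real^2^2" where
  "hess_along H v = (\<chi> i j. (\<chi> m. H$m$i$j) \<bullet> v)"

lemma conjugate_hess_along:
  "(R ** hess_along H v ** S)$a$b = (\<chi> m. (R ** (H$m) ** S)$a$b) \<bullet> v"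
  by (simp add: hess_along_def matrix_matrix_mult_def inner_vec_def sum_2 sum_3 algebra_simps)

definition normal_of :: "real^2^3 \<Rightarrow> real^3" where
  "normal_of P = (let c = column 1 P \<times> column 2 P in c /\<^sub>R norm c)"

lemma gram_entry: "(transpose P ** P)$i$j = column i P \<bullet> column j P"
  by (simp add: matrix_matrix_mult_def transpose_def column_def inner_vec_def)

text \<open>
  For fixed \<open>a\<close> and \<open>b\<close> the entries \<open>(R ** H\<^sub>m ** R)\<^sub>a\<^sub>b\<close>, \<open>m = 1, 2, 3\<close>, form a vector in space. Its normal
  component is the \<open>a b\<close> entry of the conjugated second fundamental form, and its inner products with
  the tangent vectors are linear in the tangential components of the Hessian. Hence
  \<open>tangential_part_from_gram\<close> applies to each of the four vectors.
\<close>

lemma tangential_hessian_energy_eq: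
  fixes P Q :: "real^2^3" and R :: "real^2^2"
  assumes gram: "transpose Q ** Q = transpose P ** P"
    and tang: "\<And>k. hess_along H' (column k Q) = hess_along H (column k P)"
    and c: "column 1 P \<times> column 2 P \<noteq> 0"
  shows "(\<Sum>m\<in>UNIV. (norm (R ** (H'$m) ** R))\<^sup>2) - (norm (R ** hess_along H' (normal_of Q) ** R))\<^sup>2
       = (\<Sum>m\<in>UNIV. (norm (R ** (H$m) ** R))\<^sup>2) - (norm (R ** hess_along H (normal_of P) ** R))\<^sup>2"
proof -
  define w where "w H a b = (\<chi> m. (R ** (H$m) ** R)$a$b)" for H :: "real^2^2^3" and a b
  have g: "column i Q \<bullet> column j Q = column i P \<bullet> column j P" for i j
    using gram by (metis gram_entry)
  have tw: "w H' a b \<bullet> column k Q = w H a b \<bullet> column k P" for a b k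
    unfolding w_def conjugate_hess_along[symmetric] tang ..
  have *: "(norm (w H' a b))\<^sup>2 - (w H' a b \<bullet> normal_of Q)\<^sup>2
         = (norm (w H a b))\<^sup>2 - (w H a b \<bullet> normal_of P)\<^sup>2" for a b
    unfolding normal_of_def Let_def
    by (rule tangential_part_from_gram) (simp_all add: g tw c)
  have sumeq: "(\<Sum>m\<in>UNIV. (norm (R ** (H$m) ** R))\<^sup>2) - (norm (R ** hess_along H v ** R))\<^sup>2
      = (\<Sum>a\<in>UNIV. \<Sum>b\<in>UNIV. (norm (w H a b))\<^sup>2 - (w H a b \<bullet> v)\<^sup>2)" for H v
  proof -
    have "(norm (R ** hess_along H v ** R))\<^sup>2 = (\<Sum>a\<in>UNIV. \<Sum>b\<in>UNIV. (w H a b \<bullet> v)\<^sup>2)"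
      unfolding norm_square_eq_sum_entries conjugate_hess_along w_def ..
    moreover have "(\<Sum>m\<in>UNIV. (norm (R ** (H$m) ** R))\<^sup>2)
        = (\<Sum>a\<in>UNIV. \<Sum>b\<in>UNIV. (norm (w H a b))\<^sup>2)"
      unfolding norm_square_eq_sum_entries w_def unfolding power2_norm_eq_inner
      by (simp add: inner_vec_def sum_2 sum_3 power2_eq_square)
    ultimately show ?thesis by (simp add: sum_subtractf)
  qed
  show ?thesis unfolding sumeq * ..
qed

lemma gram_det: "det (transpose P ** P) = (norm (column 1 P \<times> column 2 P))\<^sup>2"
  for P :: "real^2^3"
  using norm_cross_dot[of "column 1 P" "column 2 P"]
  unfolding power_mult_distrib power2_norm_eq_inner det_2 gram_entry
  by (simp add: power2_eq_square inner_commute)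

lemma sym_pos_def_gram:
  fixes P :: "real^2^3"
  assumes "rank P = 2"
  shows "sym_pos_def (transpose P ** P)"
proof -
  have inj: "inj ((*v) P)"
    using assms full_rank_injective[of P] by simp
  have "0 < v \<bullet> ((transpose P ** P) *v v)" if "v \<noteq> 0" for v
  proof -
    have "P *v v \<noteq> 0"
      using inj that by (metis injD matrix_vector_mult_0_right)
    then show ?thesis
      by (metis dot_lmul_matrix inner_commute inner_gt_zero_iff matrix_vector_mul_assoc
          transpose_matrix_vector)
  qed
  then show ?thesis by (simp add: sym_pos_def_def matrix_transpose_mul)
qed

section \<open>Smooth functions and mollifiers\<close>

text \<open>
  The standard function \<open>exp (- 1 / t)\<close>, together with its quotients by powers of \<open>t\<close>: the whole family is
  closed under differentiation up to linear combinations, so smoothness needs no formula for higher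
  derivatives.
\<close>

definition bump_exp :: "nat \<Rightarrow> real \<Rightarrow> real" where
  "bump_exp k t = (if 0 < t then exp (- 1 / t) / t ^ k else 0)"

lemma bump_exp_nonneg: "0 \<le> bump_exp k t"
  by (simp add: bump_exp_def)

text \<open>
  This makes each member of the family differentiable at \<open>0\<close>. It follows from
  \<open>(1 + s / n)\<^sup>n \<le> exp s\<close> with \<open>s = 1 / t\<close> and \<open>n = k + 2\<close>.
\<close>

lemma bump_exp_le_square: "bump_exp k t \<le> real (k + 2) ^ (k + 2) * t\<^sup>2"
proof (cases "0 < t")
  case True
  define n where "n = k + 2"
  have n: "n > 0" by (simp add: n_def)
  have "(1 / (t * n)) ^ n \<le> (1 + (1 / t) / n) ^ n"
    using True by (intro power_mono) auto
  also have "\<dots> \<le> exp (1 / t)"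
    using n True by (intro exp_ge_one_plus_x_over_n_power_n) (auto intro: order_trans[of _ 0])
  finally have "1 \<le> exp (1 / t) * (t * n) ^ n"
    using True n by (simp add: power_divide field_simps)
  then have "exp (- 1 / t) \<le> (t * n) ^ n"
    by (simp add: exp_minus field_simps)
  also have "\<dots> = real n ^ n * t\<^sup>2 * t ^ k"
    by (simp add: n_def power_mult_distrib power_add power2_eq_square)
  finally show ?thesis
    using True by (simp add: bump_exp_def n_def divide_le_eq)
qed (simp add: bump_exp_def)

lemma bump_exp_has_derivative:
  "(bump_exp k has_real_derivative (bump_exp (k + 2) t - real k * bump_exp (Suc k) t)) (at t)"
proof (cases t "0 :: real" rule: linorder_cases)
  case greater
  have "((\<lambda>t. exp (- 1 / t) / t ^ k) has_real_derivative
      (bump_exp (k + 2) t - real k * bump_exp (Suc k) t)) (at t)"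
    using greater
    by (auto intro!: derivative_eq_intros
        simp: bump_exp_def power2_eq_square power_add divide_simps power_eq_if[of t k]
          algebra_simps)
  then show ?thesis
    by (rule has_field_derivative_transform_within_open[where S = "{0<..}"])
      (use greater in \<open>auto simp: bump_exp_def\<close>)
next
  case less
  have "((\<lambda>t. 0) has_real_derivative (bump_exp (k + 2) t - real k * bump_exp (Suc k) t)) (at t)"
    using less by (simp add: bump_exp_def)
  then show ?thesis
    by (rule has_field_derivative_transform_within_open[where S = "{..<0}"])
      (use less in \<open>auto simp: bump_exp_def\<close>)
next
  case equal
  define C where "C = real (k + 2) ^ (k + 2)"
  have "((\<lambda>h. bump_exp k h / h) \<longlongrightarrow> 0) (at 0)"
  proof (rule Lim_null_comparison)
    show "\<forall>\<^sub>F h in at 0. norm (bump_exp k h / h) \<le> C * \<bar>h\<bar>"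
    proof (rule always_eventually, rule allI)
      fix h :: real
      show "norm (bump_exp k h / h) \<le> C * \<bar>h\<bar>"
        using bump_exp_le_square[of k h] bump_exp_nonneg[of k h]
        by (cases "h = 0")
          (auto simp: C_def divide_le_eq power2_eq_square abs_mult_self_eq mult.assoc)
    qed
    show "((\<lambda>h. C * \<bar>h\<bar>) \<longlongrightarrow> 0) (at 0)"
      by (auto intro!: tendsto_eq_intros)
  qed
  then show ?thesis
    using equal by (simp add: DERIV_def bump_exp_def)
qed

lemma bump_exp_nonpos [simp]: "t \<le> 0 \<Longrightarrow> bump_exp k t = 0"
  by (simp add: bump_exp_def)

lemma bump_exp_pos: "0 < t \<Longrightarrow> 0 < bump_exp k t"
  by (simp add: bump_exp_def)

lemma continuous_on_bump_exp [continuous_intros]: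
  "continuous_on A f \<Longrightarrow> continuous_on A (\<lambda>x. bump_exp k (f x))"
  using DERIV_continuous_on[OF has_field_derivative_at_within[OF bump_exp_has_derivative]]
  by (rule continuous_on_compose2[of UNIV "bump_exp k"]) auto

lemma has_derivative_frechet:
  "(f has_derivative f') (at x) \<Longrightarrow> (f has_derivative frechet_derivative f (at x)) (at x)"
  by (simp add: frechet_derivative_at[symmetric])

lemma partials_single:
  "(f has_derivative f') (at x) \<Longrightarrow> partials [j] f x = f' (axis j 1)"
  by (simp add: frechet_derivative_at[symmetric])

lemma partials_append: "partials is (partials js f) = partials (is @ js) f"
  by (induction "is") auto

lemma smooth_partials: "smooth f \<Longrightarrow> smooth (partials is f)"
  by (simp add: smooth_def partials_append)

lemma smooth_has_derivative:
  "smooth f \<Longrightarrow> (f has_derivative frechet_derivative f (at x)) (at x)"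
  by (metis smooth_def partials.simps(1) differentiable_on_def frechet_derivative_works
      UNIV_I)

lemma smooth_continuous: "smooth f \<Longrightarrow> continuous_on A f"
  by (metis smooth_def partials.simps(1) differentiable_imp_continuous_on continuous_on_subset
      subset_UNIV)

text \<open>
  The smooth functions form the largest set of differentiable functions closed under partial
  derivatives. Closure properties are proved by exhibiting such a set, without induction over
  multi-indices.
\<close>

lemma smooth_coinduct:
  assumes "f \<in> S" and diff: "\<And>g. g \<in> S \<Longrightarrow> g differentiable_on UNIV"
    and closed: "\<And>g i. g \<in> S \<Longrightarrow> partials [i] g \<in> S"
  shows "smooth f"
proof -
  have "partials is f \<in> S" for "is"
    by (induction "is") (use \<open>f \<in> S\<close> closed in auto)
  then show ?thesis
    by (simp add: smooth_def diff)
qed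

lemma smooth_const: "smooth (\<lambda>x. c)"
  by (rule smooth_coinduct[where S = "range (\<lambda>c x. c)"]) auto

lemma smooth_coordinate: "smooth (\<lambda>x :: real^'n::finite. x $ k)"
proof (rule smooth_coinduct[where S = "insert (\<lambda>x :: real^'n. x $ k) (range (\<lambda>c x. c))"])
  have D: "((\<lambda>x. x $ k) has_derivative (\<lambda>h. h $ k)) (at x)" for x :: "real^'n"
    by (intro bounded_linear_imp_has_derivative bounded_linear_vec_nth)
  fix g :: "real^'n \<Rightarrow> real" assume g: "g \<in> insert (\<lambda>x. x $ k) (range (\<lambda>c x. c))"
  then show "g differentiable_on UNIV"
    using D by (auto simp: differentiable_on_def differentiable_def intro: has_derivative_const)
  fix i
  have "partials [i] (\<lambda>x :: real^'n. x $ k) = (\<lambda>x. axis i 1 $ k)"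
    using partials_single[OF D] by auto
  then show "partials [i] g \<in> insert (\<lambda>x. x $ k) (range (\<lambda>c x. c))"
    using g by auto
qed auto

text \<open>
  The functions built from smooth ones by sums, products and composition with the bump family. Its
  members are differentiable with partial derivatives of the same kind, so by coinduction they are all
  smooth.
\<close>

inductive_set smooth_algebra :: "(real^'n::finite \<Rightarrow> real) set" where
  smooth: "smooth f \<Longrightarrow> f \<in> smooth_algebra"
| add: "f \<in> smooth_algebra \<Longrightarrow> g \<in> smooth_algebra \<Longrightarrow> (\<lambda>x. f x + g x) \<in> smooth_algebra"
| mult: "f \<in> smooth_algebra \<Longrightarrow> g \<in> smooth_algebra \<Longrightarrow> (\<lambda>x. f x * g x) \<in> smooth_algebra"
| bump: "f \<in> smooth_algebra \<Longrightarrow> (\<lambda>x. bump_exp k (f x)) \<in> smooth_algebra"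

lemma smooth_algebra_derivative:
  "f \<in> smooth_algebra \<Longrightarrow>
    (\<forall>x. (f has_derivative frechet_derivative f (at x)) (at x)) \<and>
    (\<forall>i. partials [i] f \<in> smooth_algebra)"
proof (induction rule: smooth_algebra.induct)
  case (smooth f)
  then show ?case
    using smooth_has_derivative smooth_partials smooth_algebra.smooth by blast
next
  case (add f g)
  have D: "((\<lambda>x. f x + g x) has_derivative
      (\<lambda>h. frechet_derivative f (at x) h + frechet_derivative g (at x) h)) (at x)" for x
    using add.IH by (intro has_derivative_add) auto
  have "partials [i] (\<lambda>x. f x + g x) = (\<lambda>x. partials [i] f x + partials [i] g x)" for i
    using partials_single[OF D] by auto
  moreover have "(\<lambda>x. partials [i] f x + partials [i] g x) \<in> smooth_algebra" for i
    using add by (intro smooth_algebra.add) auto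
  ultimately show ?case
    using D[THEN has_derivative_frechet] by (intro conjI allI) simp_all
next
  case (mult f g)
  have D: "((\<lambda>x. f x * g x) has_derivative
      (\<lambda>h. f x * frechet_derivative g (at x) h + frechet_derivative f (at x) h * g x)) (at x)" for x
    using mult.IH by (intro has_derivative_mult) auto
  have "partials [i] (\<lambda>x. f x * g x) = (\<lambda>x. f x * partials [i] g x + partials [i] f x * g x)" for i
    using partials_single[OF D] by auto
  moreover have "(\<lambda>x. f x * partials [i] g x + partials [i] f x * g x) \<in> smooth_algebra" for i
    using mult by (intro smooth_algebra.add smooth_algebra.mult) auto
  ultimately show ?case
    using D[THEN has_derivative_frechet] by (intro conjI allI) simp_all
next
  case (bump f k)
  define b' where "b' t = bump_exp (k + 2) t + (- real k) * bump_exp (Suc k) t" for t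
  have D: "((\<lambda>x. bump_exp k (f x)) has_derivative
      (\<lambda>h. b' (f x) * frechet_derivative f (at x) h)) (at x)" for x
    using has_derivative_compose[OF bump.IH[THEN conjunct1, rule_format]
        bump_exp_has_derivative[unfolded has_field_derivative_def]]
    by (simp add: b'_def)
  have "partials [i] (\<lambda>x. bump_exp k (f x)) = (\<lambda>x. b' (f x) * partials [i] f x)" for i
    using partials_single[OF D] by auto
  moreover have "(\<lambda>x. b' (f x) * partials [i] f x) \<in> smooth_algebra" for i
    unfolding b'_def using bump
    by (intro smooth_algebra.add smooth_algebra.mult smooth_algebra.bump
        smooth_algebra.smooth[OF smooth_const]) auto
  ultimately show ?case
    using D[THEN has_derivative_frechet] by (intro conjI allI) simp_all
qed

lemma smooth_algebra_smooth: "f \<in> smooth_algebra \<Longrightarrow> smooth f"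
  by (rule smooth_coinduct[where S = smooth_algebra])
    (auto simp: differentiable_on_def differentiable_def dest!: smooth_algebra_derivative)

lemma smooth_add: "smooth f \<Longrightarrow> smooth g \<Longrightarrow> smooth (\<lambda>x. f x + g x)"
  and smooth_mult: "smooth f \<Longrightarrow> smooth g \<Longrightarrow> smooth (\<lambda>x. f x * g x)"
  and smooth_bump_exp: "smooth f \<Longrightarrow> smooth (\<lambda>x. bump_exp k (f x))"
  by (rule smooth_algebra_smooth,
      intro smooth_algebra.add smooth_algebra.mult smooth_algebra.bump,
      (erule smooth_algebra.smooth)+)+

lemma smooth_sum: "finite I \<Longrightarrow> (\<And>i. i \<in> I \<Longrightarrow> smooth (f i)) \<Longrightarrow> smooth (\<lambda>x. \<Sum>i\<in>I. f i x)"
  by (induction I rule: finite_induct) (auto intro: smooth_const smooth_add)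

lemma partials_mult:
  assumes "smooth f" "smooth g"
  shows "partials [j] (\<lambda>x. f x * g x) x = f x * partials [j] g x + partials [j] f x * g x"
  using partials_single[OF has_derivative_mult[OF smooth_has_derivative smooth_has_derivative]] assms
  by simp

text \<open>
  A radial bump of radius \<open>e\<close> around \<open>y\<close>, without a normalising factor: to detect whether a continuous
  function vanishes at \<open>y\<close>, positivity near \<open>y\<close> is enough.
\<close>

definition mollifier :: "real \<Rightarrow> real^'n::finite \<Rightarrow> real^'n \<Rightarrow> real" where
  "mollifier e y x = bump_exp 0 (e\<^sup>2 - (norm (x - y))\<^sup>2)"

lemma smooth_radial_profile: "smooth (\<lambda>x :: real^'n::finite. e\<^sup>2 - (norm (x - y))\<^sup>2)"
proof -
  have eq: "(\<lambda>x. e\<^sup>2 - (norm (x - y))\<^sup>2)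
      = (\<lambda>x. e\<^sup>2 + (-1) * (\<Sum>i\<in>UNIV. (x$i + - y$i) * (x$i + - y$i)))"
    by (simp add: power2_norm_eq_inner inner_vec_def)
  show ?thesis
    unfolding eq
    by (intro smooth_add smooth_mult smooth_sum smooth_const smooth_coordinate finite)
qed

lemma smooth_mollifier: "smooth (mollifier e y)"
  unfolding mollifier_def[abs_def] by (intro smooth_bump_exp smooth_radial_profile)

lemma radial_profile_has_derivative:
  "((\<lambda>x. e\<^sup>2 - (norm (x - y))\<^sup>2) has_derivative (\<lambda>h. - 2 * ((x - y) \<bullet> h))) (at x)"
  for y :: "'a::real_inner"
  unfolding power2_norm_eq_inner
  by (auto intro!: derivative_eq_intros simp: inner_commute)

lemma bump_exp_radial_has_derivative:
  "((\<lambda>x. bump_exp k (e\<^sup>2 - (norm (x - y))\<^sup>2)) has_derivative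
     (\<lambda>h. (bump_exp (k + 2) (e\<^sup>2 - (norm (x - y))\<^sup>2) - k * bump_exp (Suc k) (e\<^sup>2 - (norm (x - y))\<^sup>2))
        * (- 2 * ((x - y) \<bullet> h)))) (at x)"
  for y :: "'a::real_inner"
  using has_derivative_compose[OF radial_profile_has_derivative
      bump_exp_has_derivative[unfolded has_field_derivative_def]]
  by (simp add: algebra_simps)

lemma partial_mollifier:
  "partials [j] (mollifier e y) x = bump_exp 2 (e\<^sup>2 - (norm (x - y))\<^sup>2) * (- 2 * (x$j - y$j))"
proof -
  have "(mollifier e y has_derivative
      (\<lambda>h. bump_exp 2 (e\<^sup>2 - (norm (x - y))\<^sup>2) * (- 2 * ((x - y) \<bullet> h)))) (at x)"
    using bump_exp_radial_has_derivative[of 0 e y x]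
    by (simp add: mollifier_def[abs_def] numeral_2_eq_2)
  from partials_single[OF this] show ?thesis
    by (simp add: inner_axis)
qed

text \<open>
  The bump depends on \<open>x - y\<close> alone, so a derivative in \<open>x\<close> may be traded for one in \<open>y\<close>. This is what
  makes the doubling of variables work.
\<close>

lemma partial_mollifier_antisym:
  "partials [j] (mollifier e y) x = - partials [j] (mollifier e x) y"
  unfolding partial_mollifier by (simp add: norm_minus_commute algebra_simps)

lemma mollifier_sym: "mollifier e y x = mollifier e x y"
  by (simp add: mollifier_def norm_minus_commute)

text \<open>
  The explicit formula is symmetric in \<open>i\<close> and \<open>j\<close>. As the bumps alone determine a locally integrable
  function, this is all that the symmetry of weak Hessians needs.
\<close>

lemma mollifier_mixed_partials:
  "partials [i, j] (mollifier e y) x = partials [j, i] (mollifier e y) x"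
proof -
  define b where "b k x = bump_exp k (e\<^sup>2 - (norm (x - y))\<^sup>2)" for k x
  have *: "partials [i, j] (mollifier e y) x
      = b 2 x * (- 2 * axis i 1 $ j) + (b 4 x - 2 * b 3 x) * (- 2 * (x$i - y$i)) * (- 2 * (x$j - y$j))"
    for i j
  proof -
    have "((\<lambda>x. b 2 x * (- 2 * (x$j - y$j))) has_derivative
        (\<lambda>h. b 2 x * (- 2 * h$j) + (b 4 x - 2 * b 3 x) * (- 2 * ((x - y) \<bullet> h)) * (- 2 * (x$j - y$j))))
        (at x)"
      using bump_exp_radial_has_derivative[of 2 e y x]
      by (intro has_derivative_mult)
        (auto simp: b_def eval_nat_numeral intro!: derivative_eq_intros
          bounded_linear_imp_has_derivative bounded_linear_vec_nth)
    from partials_single[OF this] show ?thesis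
      unfolding b_def partials.simps(2)[of i "[j]"] partial_mollifier[abs_def]
      by (simp add: inner_axis)
  qed
  show ?thesis
    unfolding * by (simp add: axis_def)
qed

lemma mollifier_nonneg: "0 \<le> mollifier e y x"
  by (simp add: mollifier_def bump_exp_nonneg)

lemma mollifier_pos: "dist x y < e \<Longrightarrow> 0 < mollifier e y x"
proof -
  assume "dist x y < e"
  then have "(norm (x - y))\<^sup>2 < e\<^sup>2"
    by (intro power_strict_mono) (auto simp: dist_norm)
  then show ?thesis by (simp add: mollifier_def bump_exp_pos)
qed

lemma mollifier_zero: "0 \<le> e \<Longrightarrow> e \<le> dist x y \<Longrightarrow> mollifier e y x = 0"
  by (simp add: mollifier_def dist_norm power_mono)

lemma mollifier_le_1: "mollifier e y x \<le> 1"
  by (simp add: mollifier_def bump_exp_def)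

lemma mollifier_support: "0 < e \<Longrightarrow> closure {x. mollifier e y x \<noteq> 0} \<subseteq> cball y e"
  by (intro closure_minimal subsetI) (use mollifier_zero[of e] in \<open>force simp: dist_commute\<close>)+

section \<open>Test functions\<close>

lemma test_function_smooth: "test_function \<omega> \<phi> \<Longrightarrow> smooth \<phi>"
  by (simp add: test_function_def)

lemma test_functionI:
  assumes "smooth \<phi>" "compact C" "C \<subseteq> \<omega>" "closure {x. \<phi> x \<noteq> 0} \<subseteq> C"
  shows "test_function \<omega> \<phi>"
proof -
  have "compact (C \<inter> closure {x. \<phi> x \<noteq> 0})"
    using assms by (intro compact_Int_closed) auto
  with assms show ?thesis
    by (simp add: test_function_def Int_absorb1)
qed

lemma test_function_mollifier:
  assumes "0 < e" "cball y e \<subseteq> \<omega>"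
  shows "test_function \<omega> (mollifier e y)"
  using mollifier_support[OF \<open>0 < e\<close>, of y] assms
  by (intro test_functionI[where C = "cball y e"] smooth_mollifier) auto

lemma test_function_mult:
  assumes "test_function \<omega> \<phi>" "smooth f"
  shows "test_function \<omega> (\<lambda>x. \<phi> x * f x)"
proof -
  have "closure {x. \<phi> x * f x \<noteq> 0} \<subseteq> closure {x. \<phi> x \<noteq> 0}"
    by (intro closure_mono) auto
  then show ?thesis
    using assms
    by (intro test_functionI[where C = "closure {x. \<phi> x \<noteq> 0}"] smooth_mult)
      (simp_all add: test_function_def)
qed

lemma partials_support:
  "x \<notin> closure {x. \<phi> x \<noteq> 0} \<Longrightarrow> partials is \<phi> x = 0"
proof (induction "is" arbitrary: x)
  case Nil
  then have "x \<notin> {x. \<phi> x \<noteq> 0}"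
    using closure_subset[of "{x. \<phi> x \<noteq> 0}"] by blast
  then show ?case by simp
next
  case (Cons i "is")
  have "((\<lambda>x. 0) has_derivative (\<lambda>h. 0)) (at x)" by simp
  then have "(partials is \<phi> has_derivative (\<lambda>h. 0)) (at x)"
    by (rule has_derivative_transform_within_open[where s = "- closure {x. \<phi> x \<noteq> 0}"])
      (use Cons in auto)
  then show ?case by (simp add: frechet_derivative_at[symmetric])
qed

lemma test_function_partials:
  assumes "test_function \<omega> \<phi>"
  shows "test_function \<omega> (partials is \<phi>)"
proof -
  have "closure {x. partials is \<phi> x \<noteq> 0} \<subseteq> closure {x. \<phi> x \<noteq> 0}"
    using partials_support by (intro closure_minimal) blast+
  then show ?thesis
    using assms
    by (intro test_functionI[where C = "closure {x. \<phi> x \<noteq> 0}"] smooth_partials)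
      (simp_all add: test_function_def)
qed

lemma test_function_support:
  assumes "test_function \<omega> \<phi>"
  obtains K where "compact K" "K \<subseteq> \<omega>" "\<And>x. x \<notin> K \<Longrightarrow> \<phi> x = 0"
    "\<And>is x. x \<notin> K \<Longrightarrow> partials is \<phi> x = 0"
proof
  show "x \<notin> closure {x. \<phi> x \<noteq> 0} \<Longrightarrow> \<phi> x = 0" for x
    using partials_support[of x \<phi> "[]"] by simp
qed (use assms partials_support in \<open>auto simp: test_function_def\<close>)

lemma test_function_bounded:
  assumes "test_function \<omega> \<phi>"
  obtains B where "\<And>x. \<bar>\<phi> x\<bar> \<le> B"
proof -
  let ?K = "closure {x. \<phi> x \<noteq> 0}"
  have "compact (\<phi> ` ?K)"
    using assms by (intro compact_continuous_image smooth_continuous) (auto simp: test_function_def)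
  then obtain B where "\<forall>x\<in>?K. \<bar>\<phi> x\<bar> \<le> B"
    by (auto dest!: compact_imp_bounded simp: bounded_iff)
  then have B: "\<bar>\<phi> x\<bar> \<le> B" if "x \<in> ?K" for x
    using that by blast
  have "\<bar>\<phi> x\<bar> \<le> max B 0" for x
    using B[of x] closure_subset[of "{x. \<phi> x \<noteq> 0}"] by (cases "\<phi> x = 0") auto
  then show ?thesis using that by blast
qed

section \<open>Translations in the mean and integrals over the diagonal\<close>

lemma integral_lborel_translate:
  fixes f :: "'a::euclidean_space \<Rightarrow> real"
  assumes [measurable]: "f \<in> borel_measurable borel"
  shows "(\<integral>x. f (x + a) \<partial>lborel) = (\<integral>x. f x \<partial>lborel)"
    and "integrable lborel (\<lambda>x. f (x + a)) \<longleftrightarrow> integrable lborel f"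
proof -
  have "(\<integral>x. f x \<partial>lborel) = (\<integral>x. f x \<partial>distr lborel borel ((+) a))"
    by (simp add: lborel_distr_plus)
  also have "\<dots> = (\<integral>x. f (x + a) \<partial>lborel)"
    by (subst integral_distr) (auto simp: add.commute)
  finally show "(\<integral>x. f (x + a) \<partial>lborel) = (\<integral>x. f x \<partial>lborel)" ..
  have "integrable lborel f \<longleftrightarrow> integrable (distr lborel borel ((+) a)) f"
    by (simp add: lborel_distr_plus)
  also have "\<dots> \<longleftrightarrow> integrable lborel (\<lambda>x. f (x + a))"
    by (subst integrable_distr_eq) (auto simp: add.commute)
  finally show "integrable lborel (\<lambda>x. f (x + a)) \<longleftrightarrow> integrable lborel f" ..
qed

lemma lborel_distr_reflect: "distr lborel borel (\<lambda>x. a - x) = (lborel :: 'a::euclidean_space measure)"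
  by (subst (2) lborel_affine[of "-1" a]) (auto simp: density_1)

lemma integral_lborel_reflect:
  fixes f :: "'a::euclidean_space \<Rightarrow> real"
  assumes [measurable]: "f \<in> borel_measurable borel"
  shows "(\<integral>x. f (a - x) \<partial>lborel) = (\<integral>x. f x \<partial>lborel)"
    and "integrable lborel (\<lambda>x. f (a - x)) \<longleftrightarrow> integrable lborel f"
proof -
  have "(\<integral>x. f x \<partial>lborel) = (\<integral>x. f x \<partial>distr lborel borel (\<lambda>x. a - x))"
    by (simp add: lborel_distr_reflect)
  also have "\<dots> = (\<integral>x. f (a - x) \<partial>lborel)"
    by (subst integral_distr) auto
  finally show "(\<integral>x. f (a - x) \<partial>lborel) = (\<integral>x. f x \<partial>lborel)" ..
  have "integrable lborel f \<longleftrightarrow> integrable (distr lborel borel (\<lambda>x. a - x)) f"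
    by (simp add: lborel_distr_reflect)
  also have "\<dots> \<longleftrightarrow> integrable lborel (\<lambda>x. f (a - x))"
    by (subst integrable_distr_eq) auto
  finally show "integrable lborel (\<lambda>x. f (a - x)) \<longleftrightarrow> integrable lborel f" ..
qed

text \<open>
  Truncations converge in the mean and in the square mean alike. They reduce approximation problems to
  bounded functions with bounded support.
\<close>

definition truncation :: "nat \<Rightarrow> ('a::euclidean_space \<Rightarrow> real) \<Rightarrow> 'a \<Rightarrow> real" where
  "truncation n f x = max (- real n) (min (real n) (f x)) * indicator (cball 0 (real n)) x"

lemma truncation_measurable [measurable]:
  assumes [measurable]: "f \<in> borel_measurable borel"
  shows "truncation n f \<in> borel_measurable borel"
proof -
  have [measurable]: "cball (0 :: 'a) (real n) \<in> sets borel" by simp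
  show ?thesis unfolding truncation_def[abs_def] by measurable
qed

lemma truncation_le: "\<bar>truncation n f x\<bar> \<le> \<bar>f x\<bar>" "\<bar>f x - truncation n f x\<bar> \<le> \<bar>f x\<bar>"
  by (auto simp: truncation_def split: split_indicator)

lemma truncation_bound: "\<bar>truncation n f x\<bar> \<le> real n * indicator (cball 0 (real n)) x"
  by (auto simp: truncation_def split: split_indicator)

lemma truncation_LIMSEQ: "(\<lambda>n. truncation n f x) \<longlonglongrightarrow> f x"
proof (rule tendsto_eventually)
  obtain N where N: "max (norm x) \<bar>f x\<bar> \<le> real N"
    using real_arch_simple by blast
  show "\<forall>\<^sub>F n in sequentially. truncation n f x = f x"
    using eventually_ge_at_top[of N]
  proof eventually_elim
    case (elim n)
    then have "real N \<le> real n" by simp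
    with N have "norm x \<le> real n" "\<bar>f x\<bar> \<le> real n" by linarith+
    then show ?case by (simp add: truncation_def)
  qed
qed

lemma integrable_indicator_cball: "integrable lborel (indicat_real (cball c r))"
  for c :: "'a::euclidean_space"
  using emeasure_lborel_cball_finite[of c r] by (intro integrable_real_indicator) auto

lemma bounded_subset_cball_0:
  fixes S :: "'a::euclidean_space set"
  assumes "bounded S" obtains R where "S \<subseteq> cball 0 R"
proof -
  obtain R where "\<forall>y\<in>S. dist 0 y \<le> R"
    using assms bounded_any_center[of S 0] by blast
  then have "S \<subseteq> cball 0 R" by (auto simp: dist_norm)
  with that show ?thesis .
qed

lemma integrable_bounded_support:
  fixes f :: "'a::euclidean_space \<Rightarrow> real"
  assumes "f \<in> borel_measurable borel" "\<And>x. \<bar>f x\<bar> \<le> B * indicator (cball 0 R) x"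
  shows "integrable lborel f"
proof (rule Bochner_Integration.integrable_bound)
  show "integrable lborel (\<lambda>x. B * indicator (cball 0 R) x :: real)"
    by (intro integrable_mult_right integrable_indicator_cball)
  show "AE x in lborel. norm (f x) \<le> norm (B * indicator (cball 0 R) x :: real)"
    using assms(2) by (intro AE_I2) (metis abs_ge_self order_trans real_norm_def)
qed (use assms in auto)

text \<open>
  Density of continuous functions with compact support. After truncation, a measurable function is an
  almost everywhere limit of continuous functions; clamping these and multiplying by a cut-off makes
  dominated convergence applicable.
\<close>

lemma integrable_approx_continuous:
  fixes f :: "'a::euclidean_space \<Rightarrow> real"
  assumes f: "integrable lborel f" and "0 < e"
  obtains h R where "continuous_on UNIV h" "\<And>x. norm x > R \<Longrightarrow> h x = 0" "integrable lborel h"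
    "(\<integral>x. \<bar>f x - h x\<bar> \<partial>lborel) < e"
proof -
  have [measurable]: "f \<in> borel_measurable borel"
    using f by auto
  have "AE x in lborel. (\<lambda>n. \<bar>f x - truncation n f x\<bar>) \<longlonglongrightarrow> \<bar>f x - f x\<bar>"
    by (intro AE_I2 tendsto_intros truncation_LIMSEQ)
  then have "(\<lambda>n. \<integral>x. \<bar>f x - truncation n f x\<bar> \<partial>lborel) \<longlonglongrightarrow> (\<integral>x. \<bar>f x - f x\<bar> \<partial>lborel)"
    by (intro integral_dominated_convergence[where w = "\<lambda>x. \<bar>f x\<bar>"])
      (use f truncation_le(2)[of f] in auto)
  then have "\<forall>\<^sub>F n in sequentially. (\<integral>x. \<bar>f x - truncation n f x\<bar> \<partial>lborel) < e / 2"
    using \<open>0 < e\<close> by (intro order_tendstoD(2)[where y = "\<integral>x. \<bar>f x - f x\<bar> \<partial>lborel"]) auto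
  then obtain n where n: "(\<integral>x. \<bar>f x - truncation n f x\<bar> \<partial>lborel) < e / 2"
    by (auto simp: eventually_sequentially)
  define g where "g = truncation n f"
  have g_meas [measurable]: "g \<in> borel_measurable borel"
    by (simp add: g_def)
  have g_bound: "\<bar>g x\<bar> \<le> real n * indicator (cball 0 (real n)) x" for x
    unfolding g_def by (rule truncation_bound)
  have g_int: "integrable lborel g"
    using g_meas g_bound by (rule integrable_bounded_support)
  have "g \<in> borel_measurable lebesgue"
    using g_meas by (simp add: measurable_completion)
  then have "g measurable_on UNIV"
    by (intro lebesgue_measurable_imp_measurable_on) auto
  then obtain N c where N: "negligible N" and c: "\<And>k::nat. continuous_on UNIV (c k)"
    and lim: "\<And>x. x \<notin> N \<Longrightarrow> (\<lambda>k. c k x) \<longlonglongrightarrow> g x"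
    by (auto simp: measurable_on_def)
  define cut where "cut x = max 0 (min 1 (real n + 1 - norm x))" for x :: 'a
  \<comment> \<open>Clamping to the bounds of \<open>g\<close> does not disturb the limit, since \<open>g\<close> already respects them.\<close>
  define h where "h k x = max (- real n) (min (real n) (c k x)) * cut x" for k x
  have h_cont: "continuous_on UNIV (h k)" for k
    unfolding h_def cut_def by (intro continuous_intros c)
  have [measurable]: "h k \<in> borel_measurable borel" for k
    using h_cont by (rule borel_measurable_continuous_onI)
  have cut: "0 \<le> cut x" "cut x \<le> indicator (cball 0 (real n + 1)) x" for x
    by (auto simp: cut_def split: split_indicator)
  have h_bound: "\<bar>h k x\<bar> \<le> real n * indicator (cball 0 (real n + 1)) x" for k x
    unfolding h_def abs_mult using cut[of x] by (intro mult_mono) auto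
  have h_lim: "(\<lambda>k. h k x) \<longlonglongrightarrow> g x" if "x \<notin> N" for x
  proof -
    have "(\<lambda>k. h k x) \<longlonglongrightarrow> max (- real n) (min (real n) (g x)) * cut x"
      unfolding h_def by (intro tendsto_intros lim that)
    also have "max (- real n) (min (real n) (g x)) * cut x = g x"
      using g_bound[of x] by (auto simp: cut_def split: split_indicator_asm)
    finally show ?thesis .
  qed
  have "(\<lambda>k. \<integral>x. \<bar>g x - h k x\<bar> \<partial>lborel) \<longlonglongrightarrow> (\<integral>x. \<bar>g x - g x\<bar> \<partial>lborel)"
  proof (rule integral_dominated_convergence)
    show "integrable lborel (\<lambda>x. \<bar>g x\<bar> + real n * indicator (cball 0 (real n + 1)) x)"
      using g_int by (intro Bochner_Integration.integrable_add integrable_abs integrable_mult_right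
          integrable_indicator_cball)
    have "AE x in lebesgue. x \<notin> N"
      using N by (intro AE_not_in) (simp add: negligible_iff_null_sets)
    then have "AE x in lborel. x \<notin> N"
      by (simp add: AE_completion_iff)
    then show "AE x in lborel. (\<lambda>k. \<bar>g x - h k x\<bar>) \<longlonglongrightarrow> \<bar>g x - g x\<bar>"
      by eventually_elim (intro tendsto_intros h_lim)
    show "AE x in lborel. norm \<bar>g x - h k x\<bar> \<le> \<bar>g x\<bar> + real n * indicator (cball 0 (real n + 1)) x" for k
      using h_bound[of k] by (intro AE_I2) (smt (verit) real_norm_def)
  qed auto
  then have "\<forall>\<^sub>F k in sequentially. (\<integral>x. \<bar>g x - h k x\<bar> \<partial>lborel) < e / 2"
    using \<open>0 < e\<close> by (intro order_tendstoD(2)[where y = "\<integral>x. \<bar>g x - g x\<bar> \<partial>lborel"]) auto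
  then obtain k where k: "(\<integral>x. \<bar>g x - h k x\<bar> \<partial>lborel) < e / 2"
    by (auto simp: eventually_sequentially)
  have h_int: "integrable lborel (h k)"
    by (rule integrable_bounded_support[OF _ h_bound]) simp
  have "(\<integral>x. \<bar>f x - h k x\<bar> \<partial>lborel) \<le> (\<integral>x. \<bar>f x - g x\<bar> + \<bar>g x - h k x\<bar> \<partial>lborel)"
    using f g_int h_int by (intro integral_mono) auto
  also have "\<dots> < e"
    using f g_int h_int n k by (subst Bochner_Integration.integral_add) (auto simp: g_def)
  finally have "(\<integral>x. \<bar>f x - h k x\<bar> \<partial>lborel) < e" .
  moreover have "h k x = 0" if "norm x > real n + 1" for x
    using h_bound[of k x] that by (auto split: split_indicator_asm)
  ultimately show ?thesis
    using that h_cont h_int by blast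
qed

text \<open>
  For a continuous function with compact support this is uniform continuity; the general case follows
  since translations preserve the integral of the absolute value.
\<close>

lemma L1_translation_continuous:
  fixes f :: "'a::euclidean_space \<Rightarrow> real"
  assumes f: "integrable lborel f" and "0 < e"
  shows "\<exists>d>0. \<forall>z. norm z < d \<longrightarrow> (\<integral>x. \<bar>f (x + z) - f x\<bar> \<partial>lborel) < e"
proof -
  obtain h R where h: "continuous_on UNIV h" "\<And>x. norm x > R \<Longrightarrow> h x = 0" "integrable lborel h"
    and fh: "(\<integral>x. \<bar>f x - h x\<bar> \<partial>lborel) < e / 3"
    using integrable_approx_continuous[OF f, of "e / 3"] \<open>0 < e\<close> by (metis zero_less_divide_iff zero_less_numeral)
  have [measurable]: "f \<in> borel_measurable borel" "h \<in> borel_measurable borel"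
    using f h by auto
  define V where "V = measure lborel (cball (0::'a) (R + 1))"
  \<comment> \<open>Chosen so that a change of \<open>h\<close> by \<open>t\<close> contributes at most \<open>e / 3\<close>, even if the volume \<open>V\<close> vanishes.\<close>
  define t where "t = e / (3 * (V + 1))"
  have V: "0 \<le> V" by (simp add: V_def)
  with \<open>0 < e\<close> have t: "0 < t" by (simp add: t_def)
  have "uniformly_continuous_on (cball 0 (R + 2)) h"
    by (intro compact_uniformly_continuous continuous_on_subset[OF h(1)]) auto
  then obtain d where d: "0 < d"
    "\<And>x y. \<lbrakk>x \<in> cball 0 (R + 2); y \<in> cball 0 (R + 2); dist y x < d\<rbrakk> \<Longrightarrow> dist (h y) (h x) < t"
    unfolding uniformly_continuous_on_def using t by metis
  have "(\<integral>x. \<bar>f (x + z) - f x\<bar> \<partial>lborel) < e" if z: "norm z < min d 1" for z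
  proof -
    have hz: "\<bar>h (x + z) - h x\<bar> \<le> t * indicator (cball 0 (R + 1)) x" for x
    proof (cases "norm x \<le> R + 1")
      case True
      have "norm (x + z) \<le> R + 2"
        using norm_triangle_ineq[of x z] True z by linarith
      then have "x + z \<in> cball 0 (R + 2)" "x \<in> cball 0 (R + 2)"
        using True by auto
      then have "dist (h (x + z)) (h x) < t"
        using z by (intro d(2)) (auto simp: dist_norm)
      with True show ?thesis
        by (simp add: dist_real_def)
    next
      case False
      have "norm x \<le> norm (x + z) + norm z"
        using norm_triangle_ineq4[of "x + z" z] by simp
      with False z have "norm (x + z) > R" by linarith
      with False show ?thesis by (simp add: h(2))
    qed
    have int: "integrable lborel (\<lambda>x. f (x + z))" "integrable lborel (\<lambda>x. h (x + z))"
      using f h by (simp_all add: integral_lborel_translate(2))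
    have ind: "integrable lborel (\<lambda>x. t * indicator (cball 0 (R + 1)) x :: real)"
      by (intro integrable_mult_right integrable_indicator_cball)
    have "(\<integral>x. \<bar>f (x + z) - f x\<bar> \<partial>lborel)
        \<le> (\<integral>x. \<bar>f (x + z) - h (x + z)\<bar> + (t * indicator (cball 0 (R + 1)) x + \<bar>f x - h x\<bar>) \<partial>lborel)"
    proof (rule integral_mono)
      fix x
      show "\<bar>f (x + z) - f x\<bar> \<le> \<bar>f (x + z) - h (x + z)\<bar> + (t * indicator (cball 0 (R + 1)) x + \<bar>f x - h x\<bar>)"
        using hz[of x] by linarith
    qed (use f h int ind in \<open>auto intro!: Bochner_Integration.integrable_add integrable_abs\<close>)
    also have "\<dots> = (\<integral>x. \<bar>f (x + z) - h (x + z)\<bar> \<partial>lborel) + (t * V + (\<integral>x. \<bar>f x - h x\<bar> \<partial>lborel))"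
      using f h int ind by (subst Bochner_Integration.integral_add; (subst Bochner_Integration.integral_add)?) (auto simp: V_def)
    also have "(\<integral>x. \<bar>f (x + z) - h (x + z)\<bar> \<partial>lborel) = (\<integral>x. \<bar>f x - h x\<bar> \<partial>lborel)"
      using integral_lborel_translate(1)[of "\<lambda>x. \<bar>f x - h x\<bar>" z] by simp
    also have "\<dots> + (t * V + \<dots>) < e"
    proof -
      have "t * V \<le> e / 3"
        using V \<open>0 < e\<close> by (simp add: t_def field_simps)
      with fh show ?thesis by linarith
    qed
    finally show ?thesis .
  qed
  then show ?thesis
    using d(1) by (intro exI[of _ "min d 1"]) auto
qed

definition correlation :: "('a::euclidean_space \<Rightarrow> real) \<Rightarrow> ('a \<Rightarrow> real) \<Rightarrow> 'a \<Rightarrow> real" where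
  "correlation f g z = (\<integral>x. f x * g (x - z) \<partial>lborel)"

lemma correlation_measurable [measurable]:
  assumes [measurable]: "f \<in> borel_measurable borel" "g \<in> borel_measurable borel"
  shows "correlation f g \<in> borel_measurable borel"
  unfolding correlation_def[abs_def] by measurable

lemma integrable_mult_bounded:
  fixes f g :: "'a::euclidean_space \<Rightarrow> real"
  assumes f: "integrable lborel f" and [measurable]: "g \<in> borel_measurable borel" and "\<And>x. \<bar>g x\<bar> \<le> B"
  shows "integrable lborel (\<lambda>x. f x * g x)"
proof (rule Bochner_Integration.integrable_bound)
  show "integrable lborel (\<lambda>x. B * f x)" using f by simp
  have "0 \<le> B" using assms(3)[of undefined] by linarith
  then have "\<bar>f x * g x\<bar> \<le> \<bar>B * f x\<bar>" for x
    using mult_right_mono[OF assms(3)[of x] abs_ge_zero[of "f x"]]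
    by (simp add: abs_mult mult.commute)
  then show "AE x in lborel. norm (f x * g x) \<le> norm (B * f x)"
    by simp
  show "(\<lambda>x. f x * g x) \<in> borel_measurable lborel" using f by measurable
qed

text \<open>
  A translation of \<open>g\<close> can be moved to \<open>f\<close>, where it is small in the mean.
\<close>

lemma correlation_tendsto_bounded:
  fixes f g :: "'a::euclidean_space \<Rightarrow> real"
  assumes f: "integrable lborel f" and [measurable]: "g \<in> borel_measurable borel"
    and B: "\<And>x. \<bar>g x\<bar> \<le> B"
  shows "(correlation f g \<longlongrightarrow> correlation f g 0) (at 0)"
proof -
  have [measurable]: "f \<in> borel_measurable borel" using f by auto
  have B0: "0 \<le> B" using B[of undefined] by linarith
  have shift: "correlation f g z = (\<integral>x. f (x + z) * g x \<partial>lborel)" for z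
    unfolding correlation_def
    using integral_lborel_translate(1)[of "\<lambda>x. f x * g (x - z)" z] by simp
  have *: "\<bar>correlation f g z - correlation f g 0\<bar> \<le> B * (\<integral>x. \<bar>f (x + z) - f x\<bar> \<partial>lborel)" for z
  proof -
    have int: "integrable lborel (\<lambda>x. f (x + z))"
      using f by (simp add: integral_lborel_translate(2))
    have "correlation f g z - correlation f g 0 = (\<integral>x. (f (x + z) - f x) * g x \<partial>lborel)"
      unfolding shift left_diff_distrib
      using integrable_mult_bounded[OF int _ B] integrable_mult_bounded[OF f _ B] by simp
    also have "\<bar>\<dots>\<bar> \<le> (\<integral>x. \<bar>(f (x + z) - f x) * g x\<bar> \<partial>lborel)"
      by (rule integral_abs_bound)
    also have "\<dots> \<le> (\<integral>x. B * \<bar>f (x + z) - f x\<bar> \<partial>lborel)"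
    proof (rule integral_mono)
      show "integrable lborel (\<lambda>x. \<bar>(f (x + z) - f x) * g x\<bar>)"
        using int f by (intro integrable_abs integrable_mult_bounded[OF _ _ B]) auto
      show "integrable lborel (\<lambda>x. B * \<bar>f (x + z) - f x\<bar>)"
        using int f by auto
      show "\<bar>(f (x + z) - f x) * g x\<bar> \<le> B * \<bar>f (x + z) - f x\<bar>" for x
        using B[of x] by (simp add: abs_mult mult.commute mult_right_mono)
    qed
    finally show ?thesis by simp
  qed
  show ?thesis
    unfolding tendsto_iff eventually_at dist_norm
  proof (intro allI impI)
    fix e :: real assume "0 < e"
    then have "0 < e / (B + 1)" using B0 by simp
    from L1_translation_continuous[OF f this] obtain d where "d > 0"
      and d: "\<And>z. norm z < d \<Longrightarrow> (\<integral>x. \<bar>f (x + z) - f x\<bar> \<partial>lborel) < e / (B + 1)" by blast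
    have "norm (correlation f g z - correlation f g 0) < e" if "norm z < d" for z
    proof -
      have "norm (correlation f g z - correlation f g 0) \<le> B * (\<integral>x. \<bar>f (x + z) - f x\<bar> \<partial>lborel)"
        using * by simp
      also have "\<dots> \<le> B * (e / (B + 1))"
        using d[OF that] B0 by (intro mult_left_mono) auto
      also have "\<dots> < e" using B0 \<open>0 < e\<close> by (simp add: field_simps)
      finally show ?thesis .
    qed
    with \<open>d > 0\<close> show "\<exists>d>0. \<forall>x\<in>UNIV. x \<noteq> 0 \<and> norm (x - 0) < d \<longrightarrow>
        norm (correlation f g x - correlation f g 0) < e" by auto
  qed
qed

text \<open>
  Fubini's theorem will be applied to \<open>f x * g (x - z)\<close>, which has to be measurable in the pair. This is
  automatic for Borel functions, but not for Lebesgue measurable ones; hence the restriction to Borel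
  representatives.
\<close>

definition L2_fun :: "('a::euclidean_space \<Rightarrow> real) \<Rightarrow> bool" where
  "L2_fun f \<longleftrightarrow> f \<in> borel_measurable borel \<and> integrable lborel (\<lambda>x. (f x)\<^sup>2)"

lemma abs_mult_le_sum_squares: "\<bar>a * b\<bar> \<le> a\<^sup>2 + b\<^sup>2" for a b :: real
  using sum_squares_bound[of "\<bar>a\<bar>" "\<bar>b\<bar>"] mult_nonneg_nonneg[OF abs_ge_zero[of a] abs_ge_zero[of b]]
  unfolding abs_mult mult.assoc by (simp only: power2_abs)

lemma L2_mult_integrable:
  assumes "L2_fun f" "L2_fun g"
  shows "integrable lborel (\<lambda>x. f x * g x)"
proof (rule Bochner_Integration.integrable_bound)
  show "integrable lborel (\<lambda>x. (f x)\<^sup>2 + (g x)\<^sup>2)"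
    using assms by (auto simp: L2_fun_def)
  show "(\<lambda>x. f x * g x) \<in> borel_measurable lborel"
    using assms by (auto simp: L2_fun_def)
  show "AE x in lborel. norm (f x * g x) \<le> norm ((f x)\<^sup>2 + (g x)\<^sup>2)"
    using abs_mult_le_sum_squares by (intro AE_I2) simp
qed

text \<open>
  The discriminant argument for \<open>t \<mapsto> \<integral> (t * f x - g x)\<^sup>2 dx\<close>.
\<close>

lemma L2_Cauchy_Schwarz:
  assumes f: "L2_fun f" and g: "L2_fun g"
  shows "\<bar>\<integral>x. f x * g x \<partial>lborel\<bar> \<le> sqrt (\<integral>x. (f x)\<^sup>2 \<partial>lborel) * sqrt (\<integral>x. (g x)\<^sup>2 \<partial>lborel)"
proof -
  define A B C where "A = (\<integral>x. (f x)\<^sup>2 \<partial>lborel)" and "B = (\<integral>x. f x * g x \<partial>lborel)"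
    and "C = (\<integral>x. (g x)\<^sup>2 \<partial>lborel)"
  have quad: "0 \<le> A * t\<^sup>2 - 2 * B * t + C" for t
  proof -
    have "0 \<le> (\<integral>x. (t * f x - g x)\<^sup>2 \<partial>lborel)" by simp
    also have "(\<lambda>x. (t * f x - g x)\<^sup>2) = (\<lambda>x. t\<^sup>2 * (f x)\<^sup>2 + ((- 2 * t) * (f x * g x) + (g x)\<^sup>2))"
      by (auto simp: power2_eq_square algebra_simps)
    also have "(\<integral>x. t\<^sup>2 * (f x)\<^sup>2 + ((- 2 * t) * (f x * g x) + (g x)\<^sup>2) \<partial>lborel)
        = t\<^sup>2 * A + ((- 2 * t) * B + C)"
      using f g L2_mult_integrable[OF f g] unfolding A_def B_def C_def L2_fun_def
      by (subst Bochner_Integration.integral_add; (subst Bochner_Integration.integral_add)?) auto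
    finally show ?thesis by (simp add: algebra_simps)
  qed
  have A: "0 \<le> A" "0 \<le> C" by (simp_all add: A_def C_def)
  have "B\<^sup>2 \<le> A * C"
  proof (cases "A = 0")
    case True
    \<comment> \<open>A nonzero linear coefficient would make the quadratic equal to \<open>- 1\<close> at this argument.\<close>
    have "B = 0"
      using quad[of "(C + 1) / (2 * B)"] True A by (cases "B = 0") auto
    with True show ?thesis by simp
  next
    case False
    then show ?thesis
      using quad[of "B / A"] A by (simp add: power2_eq_square field_simps)
  qed
  then have "\<bar>B\<bar> \<le> sqrt (A * C)"
    using real_sqrt_le_mono[of "B\<^sup>2" "A * C"] by simp
  then show ?thesis
    by (simp add: real_sqrt_mult A_def B_def C_def)
qed

lemma L2_translate:
  assumes "L2_fun f"
  shows "L2_fun (\<lambda>x. f (x - z))" "(\<integral>x. (f (x - z))\<^sup>2 \<partial>lborel) = (\<integral>x. (f x)\<^sup>2 \<partial>lborel)"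
  using assms integral_lborel_translate[of "\<lambda>x. (f x)\<^sup>2" "- z"] by (auto simp: L2_fun_def)

lemma L2_truncation:
  assumes f: "L2_fun f"
  shows "L2_fun (truncation n f)" "L2_fun (\<lambda>x. f x - truncation n f x)"
    "(\<integral>x. (truncation n f x)\<^sup>2 \<partial>lborel) \<le> (\<integral>x. (f x)\<^sup>2 \<partial>lborel)"
    "(\<lambda>n. \<integral>x. (f x - truncation n f x)\<^sup>2 \<partial>lborel) \<longlonglongrightarrow> 0"
proof -
  have [measurable]: "f \<in> borel_measurable borel" and f2: "integrable lborel (\<lambda>x. (f x)\<^sup>2)"
    using f by (auto simp: L2_fun_def)
  have le: "(truncation n f x)\<^sup>2 \<le> (f x)\<^sup>2" "(f x - truncation n f x)\<^sup>2 \<le> (f x)\<^sup>2" for n x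
    using truncation_le by (metis abs_le_square_iff)+
  have int: "integrable lborel (\<lambda>x. (truncation n f x)\<^sup>2)"
    by (rule Bochner_Integration.integrable_bound[OF f2]) (use le in auto)
  then show "L2_fun (truncation n f)" by (simp add: L2_fun_def)
  show "(\<integral>x. (truncation n f x)\<^sup>2 \<partial>lborel) \<le> (\<integral>x. (f x)\<^sup>2 \<partial>lborel)"
    by (rule integral_mono[OF int f2]) (rule le)
  have "integrable lborel (\<lambda>x. (f x - truncation n f x)\<^sup>2)"
    by (rule Bochner_Integration.integrable_bound[OF f2]) (use le in auto)
  then show "L2_fun (\<lambda>x. f x - truncation n f x)" by (simp add: L2_fun_def)
  have "AE x in lborel. (\<lambda>n. (f x - truncation n f x)\<^sup>2) \<longlonglongrightarrow> (f x - f x)\<^sup>2"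
    by (intro AE_I2 tendsto_intros truncation_LIMSEQ)
  then have "(\<lambda>n. \<integral>x. (f x - truncation n f x)\<^sup>2 \<partial>lborel) \<longlonglongrightarrow> (\<integral>x. (f x - f x)\<^sup>2 \<partial>lborel)"
    by (intro integral_dominated_convergence[where w = "\<lambda>x. (f x)\<^sup>2"]) (use f2 le in auto)
  then show "(\<lambda>n. \<integral>x. (f x - truncation n f x)\<^sup>2 \<partial>lborel) \<longlonglongrightarrow> 0" by simp
qed

text \<open>
  Truncating both factors changes the correlation little, uniformly in \<open>z\<close>, by the Cauchy--Schwarz
  inequality; the truncated factors are covered by \<open>correlation_tendsto_bounded\<close>.
\<close>

lemma correlation_tendsto_L2:
  fixes f g :: "'a::euclidean_space \<Rightarrow> real"
  assumes f: "L2_fun f" and g: "L2_fun g"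
  shows "(correlation f g \<longlongrightarrow> correlation f g 0) (at 0)"
proof -
  define N where "N f = sqrt (\<integral>x. (f x)\<^sup>2 \<partial>lborel)" for f :: "'a \<Rightarrow> real"
  define r where "r n = N (\<lambda>x. f x - truncation n f x) * N g + N f * N (\<lambda>x. g x - truncation n g x)" for n
  have N0: "0 \<le> N f" for f by (simp add: N_def)
  have close: "\<bar>correlation f g z - correlation (truncation n f) (truncation n g) z\<bar> \<le> r n" for n z
  proof -
    note tg = L2_translate(1)[OF L2_truncation(1)[OF g]] L2_translate(1)[OF L2_truncation(2)[OF g]]
    have eq: "correlation f g z - correlation (truncation n f) (truncation n g) z
        = (\<integral>x. (f x - truncation n f x) * g (x - z) \<partial>lborel)
        + (\<integral>x. truncation n f x * (g (x - z) - truncation n g (x - z)) \<partial>lborel)"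
      unfolding correlation_def left_diff_distrib right_diff_distrib
      using tg by (simp add: L2_mult_integrable L2_truncation(1,2) L2_translate(1) f g)
    have "\<bar>correlation f g z - correlation (truncation n f) (truncation n g) z\<bar>
        \<le> N (\<lambda>x. f x - truncation n f x) * N (\<lambda>x. g (x - z))
        + N (truncation n f) * N (\<lambda>x. g (x - z) - truncation n g (x - z))"
      unfolding N_def eq
      by (intro order_trans[OF abs_triangle_ineq] add_mono L2_Cauchy_Schwarz) 
        (simp_all add: tg L2_truncation(1,2) L2_translate(1) f g)
    also have "\<dots> \<le> r n"
    proof -
      have le: "N (truncation n f) \<le> N f"
        unfolding N_def by (rule real_sqrt_le_mono[OF L2_truncation(3)[OF f]])
      have N1: "N (\<lambda>x. g (x - z)) = N g"
        unfolding N_def L2_translate(2)[OF g] ..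
      have N2: "N (\<lambda>x. g (x - z) - truncation n g (x - z)) = N (\<lambda>x. g x - truncation n g x)"
        unfolding N_def L2_translate(2)[OF L2_truncation(2)[OF g]] ..
      show ?thesis
        unfolding r_def N1 N2 by (intro add_left_mono mult_right_mono le N0)
    qed
    finally show ?thesis .
  qed
  have "r \<longlonglongrightarrow> sqrt 0 * N g + N f * sqrt 0"
    unfolding r_def N_def by (intro tendsto_intros L2_truncation f g)
  then have r: "r \<longlonglongrightarrow> 0" by simp
  show ?thesis
    unfolding tendsto_iff
  proof (intro allI impI)
    fix e :: real assume "0 < e"
    then have "\<forall>\<^sub>F n in sequentially. r n < e / 3"
      using r by (intro order_tendstoD) auto
    then obtain n where n: "r n < e / 3" by (auto simp: eventually_sequentially)
    have "integrable lborel (truncation n f)"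
      using f by (intro integrable_bounded_support[OF _ truncation_bound]) (auto simp: L2_fun_def)
    moreover have "\<bar>truncation n g x\<bar> \<le> real n" for x
      using truncation_bound[of n g x] by (auto split: split_indicator_asm)
    ultimately have "(correlation (truncation n f) (truncation n g) \<longlongrightarrow>
        correlation (truncation n f) (truncation n g) 0) (at 0)"
      using g by (intro correlation_tendsto_bounded) (auto simp: L2_fun_def)
    then have "\<forall>\<^sub>F z in at 0. dist (correlation (truncation n f) (truncation n g) z)
        (correlation (truncation n f) (truncation n g) 0) < e / 3"
      using \<open>0 < e\<close> by (intro tendstoD) auto
    then show "\<forall>\<^sub>F z in at 0. dist (correlation f g z) (correlation f g 0) < e"
    proof eventually_elim
      case (elim z)
      with close[of z n] close[of 0 n] n show ?case
        unfolding dist_real_def by linarith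
    qed
  qed
qed

lemma integrable_pair_weighted:
  fixes f :: "'a::euclidean_space \<Rightarrow> real" and h :: "'a \<Rightarrow> 'b::euclidean_space \<Rightarrow> real"
  assumes f: "integrable lborel f" and h_meas [measurable]: "case_prod h \<in> borel_measurable (borel \<Otimes>\<^sub>M borel)"
    and h: "\<And>x. integrable lborel (h x)" and M: "\<And>x. (\<integral>y. \<bar>h x y\<bar> \<partial>lborel) \<le> M"
  shows "integrable (lborel \<Otimes>\<^sub>M lborel) (\<lambda>(x, y). f x * h x y)"
proof (rule lborel_pair.Fubini_integrable)
  have [measurable]: "f \<in> borel_measurable borel" using f by auto
  have "0 \<le> (\<integral>y. \<bar>h undefined y\<bar> \<partial>lborel)" by simp
  then have M0: "0 \<le> M" using M[of undefined] by linarith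
  show "(\<lambda>(x, y). f x * h x y) \<in> borel_measurable (lborel \<Otimes>\<^sub>M lborel)"
    by measurable
  show "AE x in lborel. integrable lborel (\<lambda>y. case (x, y) of (x, y) \<Rightarrow> f x * h x y)"
    using h by auto
  show "integrable lborel (\<lambda>x. \<integral>y. norm (case (x, y) of (x, y) \<Rightarrow> f x * h x y) \<partial>lborel)"
  proof (rule Bochner_Integration.integrable_bound)
    show "integrable lborel (\<lambda>x. f x * M)" using f by simp
    show "(\<lambda>x. \<integral>y. norm (case (x, y) of (x, y) \<Rightarrow> f x * h x y) \<partial>lborel) \<in> borel_measurable lborel"
      by measurable
    show "AE x in lborel. norm (\<integral>y. norm (case (x, y) of (x, y) \<Rightarrow> f x * h x y) \<partial>lborel) \<le> norm (f x * M)"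
      using M M0 by (intro AE_I2) (simp add: abs_mult[of "f _"] mult_left_mono)
  qed
qed

text \<open>
  The substitution \<open>y = x - z\<close> followed by an exchange of the integrations.
\<close>

lemma doubled_integral_eq_correlation:
  fixes f g :: "'a::euclidean_space \<Rightarrow> real"
  assumes f: "integrable lborel f" and g: "integrable lborel g"
    and [measurable]: "k \<in> borel_measurable borel" and B: "\<And>z. \<bar>k z\<bar> \<le> B"
  shows "integrable lborel (\<lambda>z. correlation f g z * k z)"
    and "(\<integral>x. (\<integral>y. f x * g y * k (x - y) \<partial>lborel) \<partial>lborel) = (\<integral>z. correlation f g z * k z \<partial>lborel)"
proof -
  have [measurable]: "f \<in> borel_measurable borel" "g \<in> borel_measurable borel"
    using f g by auto
  define H where "H x z = f x * (g (x - z) * k z)" for x z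
  have gz: "integrable lborel (\<lambda>z. g (x - z))" for x
    using g by (simp add: integral_lborel_reflect(2))
  have gk: "integrable lborel (\<lambda>z. g (x - z) * k z)" for x
    using B by (intro integrable_mult_bounded[OF gz]) auto
  have inner: "(\<integral>z. \<bar>g (x - z) * k z\<bar> \<partial>lborel) \<le> B * (\<integral>y. \<bar>g y\<bar> \<partial>lborel)" for x
  proof -
    have "(\<integral>z. \<bar>g (x - z) * k z\<bar> \<partial>lborel) \<le> (\<integral>z. B * \<bar>g (x - z)\<bar> \<partial>lborel)"
    proof (rule integral_mono)
      show "integrable lborel (\<lambda>z. \<bar>g (x - z) * k z\<bar>)"
        using gk by (rule integrable_abs)
      show "integrable lborel (\<lambda>z. B * \<bar>g (x - z)\<bar>)"
        using gz by (intro integrable_mult_right integrable_abs)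
      show "\<bar>g (x - z) * k z\<bar> \<le> B * \<bar>g (x - z)\<bar>" for z
        using mult_right_mono[OF B[of z] abs_ge_zero[of "g (x - z)"]]
        by (simp add: abs_mult mult.commute)
    qed
    also have "\<dots> = B * (\<integral>y. \<bar>g y\<bar> \<partial>lborel)"
      using integral_lborel_reflect(1)[of "\<lambda>y. \<bar>g y\<bar>" x] by simp
    finally show ?thesis .
  qed
  have Hint: "integrable (lborel \<Otimes>\<^sub>M lborel) (case_prod H)"
    unfolding H_def by (rule integrable_pair_weighted[OF f _ gk inner]) measurable
  have swap: "(\<integral>x. H x z \<partial>lborel) = correlation f g z * k z" for z
    by (simp add: H_def correlation_def flip: mult.assoc)
  show "integrable lborel (\<lambda>z. correlation f g z * k z)"
    using lborel_pair.integrable_snd[OF Hint] by (simp add: swap)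
  have "(\<integral>y. f x * g y * k (x - y) \<partial>lborel) = (\<integral>z. H x z \<partial>lborel)" for x
    using integral_lborel_reflect(1)[of "\<lambda>y. f x * g y * k (x - y)" x, symmetric]
    by (simp add: H_def mult.assoc)
  then have "(\<integral>x. (\<integral>y. f x * g y * k (x - y) \<partial>lborel) \<partial>lborel) = (\<integral>x. (\<integral>z. H x z \<partial>lborel) \<partial>lborel)"
    by simp
  also have "\<dots> = (\<integral>z. (\<integral>x. H x z \<partial>lborel) \<partial>lborel)"
    using lborel_pair.Fubini_integral[OF Hint] ..
  finally show "(\<integral>x. (\<integral>y. f x * g y * k (x - y) \<partial>lborel) \<partial>lborel) = (\<integral>z. correlation f g z * k z \<partial>lborel)"
    by (simp add: swap)
qed

lemma continuous_on_mollifier: "continuous_on A (mollifier e y)"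
  by (rule smooth_continuous[OF smooth_mollifier])

lemma borel_measurable_mollifier [measurable]: "mollifier e y \<in> borel_measurable borel"
  by (rule borel_measurable_continuous_onI[OF continuous_on_mollifier])

lemma integrable_mollifier:
  assumes "0 < e" shows "integrable lborel (mollifier e (0 :: real^'n::finite))"
proof (rule integrable_bounded_support[where B = 1 and R = e])
  show "\<bar>mollifier e 0 x\<bar> \<le> 1 * indicator (cball 0 e) x" for x :: "real^'n"
    using mollifier_zero[of e x 0] mollifier_le_1[of e 0 x] mollifier_nonneg[of e 0 x] assms
    by (auto split: split_indicator)
qed simp

lemma integral_mollifier_pos:
  assumes "0 < e" shows "0 < (\<integral>x. mollifier e (0 :: real^'n::finite) x \<partial>lborel)"
proof -
  have "(\<integral>x. mollifier e (0 :: real^'n) x \<partial>lborel) \<noteq> 0"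
  proof
    assume "(\<integral>x. mollifier e (0 :: real^'n) x \<partial>lborel) = 0"
    then have "AE x in lborel. mollifier e (0 :: real^'n) x = 0"
      using integral_nonneg_eq_0_iff_AE[OF integrable_mollifier[OF assms]] mollifier_nonneg by auto
    then have "AE x in lborel. x \<notin> ball (0 :: real^'n) e"
      by eventually_elim (use mollifier_pos[of _ 0 e] in \<open>force simp: dist_commute\<close>)
    then have "ball (0 :: real^'n) e \<in> null_sets lborel"
      by (subst AE_iff_null_sets) auto
    then have "negligible (ball (0 :: real^'n) e)"
      unfolding negligible_iff_null_sets by (rule null_sets_completionI)
    with assms show False
      using open_not_negligible[of "ball (0 :: real^'n) e"] by simp
  qed
  moreover have "0 \<le> (\<integral>x. mollifier e (0 :: real^'n) x \<partial>lborel)"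
    by (simp add: mollifier_nonneg)
  ultimately show ?thesis by linarith
qed

text \<open>
  The limiting step of the doubling of variables. The double integrals are the averages of a sum \<open>J\<close>
  of correlations against a positive bump. If they all vanish and \<open>J\<close> is continuous at \<open>0\<close>, then
  \<open>J 0 = 0\<close>, and \<open>J 0\<close> is the sum of the integrals over the diagonal. Finite sums are needed because in the
  product rule only the three terms together vanish.
\<close>

lemma diagonal_integral_zero:
  fixes f g :: "'i \<Rightarrow> real^'n::finite \<Rightarrow> real"
  assumes int: "\<And>i. i \<in> I \<Longrightarrow> integrable lborel (f i)" "\<And>i. i \<in> I \<Longrightarrow> integrable lborel (g i)"
    and lim: "\<And>i. i \<in> I \<Longrightarrow> (correlation (f i) (g i) \<longlongrightarrow> correlation (f i) (g i) 0) (at 0)"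
    and "0 < r"
    and zero: "\<And>e. 0 < e \<Longrightarrow> e < r \<Longrightarrow>
      (\<Sum>i\<in>I. \<integral>x. (\<integral>y. f i x * g i y * mollifier e y x \<partial>lborel) \<partial>lborel) = 0"
  shows "(\<Sum>i\<in>I. \<integral>x. f i x * g i x \<partial>lborel) = 0"
proof (rule ccontr)
  define J where "J z = (\<Sum>i\<in>I. correlation (f i) (g i) z)" for z
  assume "(\<Sum>i\<in>I. \<integral>x. f i x * g i x \<partial>lborel) \<noteq> 0"
  then have J0: "J 0 \<noteq> 0" by (simp add: J_def correlation_def)
  have "(J \<longlongrightarrow> J 0) (at 0)"
    unfolding J_def by (intro tendsto_sum lim)
  then have "\<forall>\<^sub>F z in at 0. dist (J z) (J 0) < \<bar>J 0\<bar> / 2"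
    using J0 by (intro tendstoD) auto
  then obtain d where "0 < d" and "\<And>z. z \<noteq> 0 \<Longrightarrow> dist z 0 < d \<Longrightarrow> dist (J z) (J 0) < \<bar>J 0\<bar> / 2"
    unfolding eventually_at by blast
  then have d: "\<bar>J z - J 0\<bar> \<le> \<bar>J 0\<bar> / 2" if "dist z 0 < d" for z
    using that by (cases "z = 0") (auto simp: dist_real_def less_imp_le)
  \<comment> \<open>Inside the support of this bump, \<open>J\<close> stays within \<open>\<bar>J 0\<bar> / 2\<close> of its value at \<open>0\<close>.\<close>
  define e where "e = min d r / 2"
  have e: "0 < e" "e < r" "e < d"
    using \<open>0 < d\<close> \<open>0 < r\<close> by (auto simp: e_def min_def)
  define k where "k = mollifier e (0 :: real^'n)"
  have k: "k \<in> borel_measurable borel" "\<And>z. \<bar>k z\<bar> \<le> 1" "integrable lborel k" "0 < (\<integral>z. k z \<partial>lborel)"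
    "\<And>z. 0 \<le> k z"
    unfolding k_def using mollifier_nonneg[of e "0 :: real^'n"] mollifier_le_1[of e "0 :: real^'n"]
      integrable_mollifier[OF e(1)] integral_mollifier_pos[OF e(1)] by auto
  have kxy: "mollifier e y x = k (x - y)" for x y :: "real^'n"
    by (simp add: k_def mollifier_def)
  have Jint: "integrable lborel (\<lambda>z. J z * k z)"
    unfolding J_def sum_distrib_right
    by (intro Bochner_Integration.integrable_sum doubled_integral_eq_correlation(1)[OF int _ k(2)]) (auto simp: k)
  have "(\<integral>z. J z * k z \<partial>lborel) = (\<Sum>i\<in>I. \<integral>z. correlation (f i) (g i) z * k z \<partial>lborel)"
    unfolding J_def sum_distrib_right
    by (intro Bochner_Integration.integral_sum doubled_integral_eq_correlation(1)[OF int _ k(2)]) (auto simp: k)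
  also have "\<dots> = 0"
    using zero[OF e(1,2)] doubled_integral_eq_correlation(2)[OF int k(1,2)] by (simp add: kxy)
  finally have J: "(\<integral>z. J z * k z \<partial>lborel) = 0" .
  have "\<bar>J 0\<bar> * (\<integral>z. k z \<partial>lborel) = \<bar>\<integral>z. J 0 * k z - J z * k z \<partial>lborel\<bar>"
    using J Jint k by (simp add: abs_mult)
  also have "\<dots> \<le> (\<integral>z. \<bar>J 0 * k z - J z * k z\<bar> \<partial>lborel)"
    by (rule integral_abs_bound)
  also have "\<dots> \<le> (\<integral>z. \<bar>J 0\<bar> / 2 * k z \<partial>lborel)"
  proof (rule integral_mono)
    show "\<bar>J 0 * k z - J z * k z\<bar> \<le> \<bar>J 0\<bar> / 2 * k z" for z
    proof (cases "dist z 0 < d")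
      case True
      have "\<bar>J 0 * k z - J z * k z\<bar> = \<bar>J z - J 0\<bar> * k z"
        using k(5)[of z] by (simp add: abs_mult abs_minus_commute flip: left_diff_distrib)
      then show ?thesis
        using mult_right_mono[OF d[OF True] k(5)[of z]] by simp
    next
      case False
      then have "k z = 0"
        unfolding k_def using e by (intro mollifier_zero) auto
      then show ?thesis by simp
    qed
  qed (use Jint k in auto)
  also have "\<dots> = \<bar>J 0\<bar> / 2 * (\<integral>z. k z \<partial>lborel)" by simp
  finally show False
    using J0 k(4) by simp
qed

section \<open>Uniqueness of weak derivatives\<close>

lemma AE_lebesgue_on_iff:
  "S \<in> sets lebesgue \<Longrightarrow> (AE x in lebesgue_on S. P x) \<longleftrightarrow> (AE x in lborel. x \<in> S \<longrightarrow> P x)"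
  by (simp add: AE_restrict_space_iff AE_completion_iff)

lemma borel_extension:
  fixes u :: "'a::euclidean_space \<Rightarrow> real"
  assumes S: "S \<in> sets borel" and u: "u \<in> borel_measurable (lebesgue_on S)"
  obtains U where "U \<in> borel_measurable borel" "\<And>x. x \<notin> S \<Longrightarrow> U x = 0"
    "AE x in lebesgue_on S. u x = U x"
proof -
  have S': "S \<in> sets lebesgue"
    using S by simp
  have "(\<lambda>x. indicator S x * u x) \<in> borel_measurable lebesgue"
    using u S' by (simp add: borel_measurable_restrict_space_iff)
  then obtain U where U: "U \<in> borel_measurable lborel" and eq: "AE x in lborel. indicator S x * u x = U x"
    by (blast dest: completion_ex_borel_measurable_real)
  show ?thesis
  proof
    show "(\<lambda>x. indicator S x * U x) \<in> borel_measurable borel"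
      using U S by auto
    show "AE x in lebesgue_on S. u x = indicator S x * U x"
      unfolding AE_lebesgue_on_iff[OF S'] using eq by eventually_elim auto
  qed auto
qed

text \<open>
  The passage from Lebesgue measure on \<open>S\<close> to Borel functions on the whole space, where Fubini's theorem
  and translation invariance are at hand.
\<close>

lemma lebesgue_on_eq_lborel:
  fixes w W :: "'a::euclidean_space \<Rightarrow> real"
  assumes S: "S \<in> sets borel" and w: "w \<in> borel_measurable (lebesgue_on S)"
    and W: "W \<in> borel_measurable borel" "\<And>x. x \<notin> S \<Longrightarrow> W x = 0"
    and eq: "AE x in lebesgue_on S. w x = W x"
  shows "integral\<^sup>L (lebesgue_on S) w = (\<integral>x. W x \<partial>lborel)"
    and "integrable (lebesgue_on S) w \<longleftrightarrow> integrable lborel W"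
proof -
  have S': "S \<in> sets lebesgue" using S by simp
  have m: "(\<lambda>x. indicator S x * w x) \<in> borel_measurable lebesgue"
    using w S' by (simp add: borel_measurable_restrict_space_iff)
  have "AE x in lborel. indicator S x * w x = W x"
    using eq unfolding AE_lebesgue_on_iff[OF S'] by eventually_elim (use W(2) in \<open>auto simp: indicator_def\<close>)
  then have ae: "AE x in lebesgue. indicator S x * w x = W x"
    by (rule AE_completion)
  have W': "W \<in> borel_measurable lebesgue"
    using W(1) by (simp add: measurable_completion)
  have "integral\<^sup>L (lebesgue_on S) w = integral\<^sup>L lebesgue (\<lambda>x. indicator S x * w x)"
    using S' by (simp add: integral_restrict_space)
  also have "\<dots> = integral\<^sup>L lebesgue W"
    by (rule integral_cong_AE[OF m W' ae])
  also have "\<dots> = (\<integral>x. W x \<partial>lborel)"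
    using W(1) by (intro integral_completion) simp
  finally show "integral\<^sup>L (lebesgue_on S) w = (\<integral>x. W x \<partial>lborel)" .
  have "integrable (lebesgue_on S) w \<longleftrightarrow> integrable lebesgue (\<lambda>x. indicator S x * w x)"
    using S' by (simp add: integrable_restrict_space)
  also have "\<dots> \<longleftrightarrow> integrable lebesgue W"
    by (rule integrable_cong_AE[OF m W' ae])
  also have "\<dots> \<longleftrightarrow> integrable lborel W"
    using W(1) by (intro integrable_completion) simp
  finally show "integrable (lebesgue_on S) w \<longleftrightarrow> integrable lborel W" .
qed

lemma borel_measurable_lebesgue_on:
  "f \<in> borel_measurable borel \<Longrightarrow> f \<in> borel_measurable (lebesgue_on S)"
  by (rule measurable_restrict_space1) (simp add: measurable_completion)

lemma test_function_measurable: "test_function \<omega> \<phi> \<Longrightarrow> \<phi> \<in> borel_measurable borel"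
  by (intro borel_measurable_continuous_onI smooth_continuous test_function_smooth)

lemma integrable_lebesgue_on_subset:
  fixes u :: "'a::euclidean_space \<Rightarrow> real"
  assumes "integrable (lebesgue_on S) u" "S \<in> sets lebesgue" "T \<in> sets lebesgue" "T \<subseteq> S"
  shows "integrable (lebesgue_on T) u"
proof -
  have "integrable lebesgue (\<lambda>x. indicator S x *\<^sub>R u x)"
    using assms by (simp add: integrable_restrict_space)
  then have "integrable lebesgue (\<lambda>x. indicator T x *\<^sub>R (indicator S x *\<^sub>R u x))"
    using assms(3) by (rule integrable_mult_indicator[rotated])
  also have "(\<lambda>x. indicator T x *\<^sub>R (indicator S x *\<^sub>R u x)) = (\<lambda>x. indicator T x *\<^sub>R u x)"
    using assms(4) by (auto simp: fun_eq_iff indicator_def)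
  finally show ?thesis
    using assms(3) by (simp add: integrable_restrict_space)
qed

lemma locally_integrable_test_integrable:
  assumes \<omega>: "open \<omega>" and u: "locally_integrable \<omega> u" and \<phi>: "test_function \<omega> \<phi>"
  shows "integrable (lebesgue_on \<omega>) (\<lambda>x. u x * \<phi> x)"
proof -
  obtain K where K: "compact K" "K \<subseteq> \<omega>" and \<phi>K: "\<And>x. x \<notin> K \<Longrightarrow> \<phi> x = 0"
    using test_function_support[OF \<phi>] by metis
  then have K': "K \<in> sets lebesgue"
    by (simp add: compact_imp_closed)
  obtain B where B: "\<And>x. \<bar>\<phi> x\<bar> \<le> B"
    using test_function_bounded[OF \<phi>] by blast
  have "integrable (lebesgue_on K) u"
    using u K by (simp add: locally_integrable_def)
  then have uK: "integrable lebesgue (\<lambda>x. indicator K x * u x)"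
    using K' by (simp add: integrable_restrict_space)
  have "integrable lebesgue (\<lambda>x. indicator K x * u x * \<phi> x)"
  proof (rule Bochner_Integration.integrable_bound)
    show "integrable lebesgue (\<lambda>x. B * (indicator K x * u x))" using uK by simp
    have [measurable]: "\<phi> \<in> borel_measurable lebesgue"
      using test_function_measurable[OF \<phi>] by (simp add: measurable_completion)
    show "(\<lambda>x. indicator K x * u x * \<phi> x) \<in> borel_measurable lebesgue"
      using borel_measurable_integrable[OF uK] by measurable
    have "\<bar>indicator K x * u x * \<phi> x\<bar> \<le> \<bar>B * (indicator K x * u x)\<bar>" for x
      using mult_right_mono[OF order_trans[OF B abs_ge_self], of "\<bar>indicator K x * u x\<bar>" x]
      by (simp add: abs_mult mult_ac)
    then show "AE x in lebesgue. norm (indicator K x * u x * \<phi> x) \<le> norm (B * (indicator K x * u x))"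
      by simp
  qed
  also have "(\<lambda>x. indicator K x * u x * \<phi> x) = (\<lambda>x. indicator \<omega> x *\<^sub>R (u x * \<phi> x))"
    using K(2) \<phi>K by (force split: split_indicator)
  finally show ?thesis
    using \<omega> by (simp add: integrable_restrict_space)
qed

lemma compact_thickening:
  fixes K :: "'a::euclidean_space set"
  assumes "compact K" shows "compact (\<Union>x\<in>K. cball x r)"
proof -
  have "(\<Union>x\<in>K. cball x r) = {x + y |x y. x \<in> K \<and> y \<in> cball 0 r}"
    by (auto simp: dist_norm intro!: bexI) (metis add_diff_cancel_left' diff_add_cancel norm_minus_commute add.commute)
  then show ?thesis
    using compact_sums[OF assms compact_cball[of 0 r]] by simp
qed

lemma doubled_integral_swap:
  fixes f g :: "'a::euclidean_space \<Rightarrow> real" and k :: "'a \<Rightarrow> 'a \<Rightarrow> real"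
  assumes f: "integrable lborel f" and g: "integrable lborel g"
    and [measurable]: "case_prod k \<in> borel_measurable (borel \<Otimes>\<^sub>M borel)" and B: "\<And>x y. \<bar>k x y\<bar> \<le> B"
  shows "(\<integral>x. (\<integral>y. f x * g y * k x y \<partial>lborel) \<partial>lborel) = (\<integral>y. g y * (\<integral>x. f x * k x y \<partial>lborel) \<partial>lborel)"
    and "integrable lborel (\<lambda>y. g y * (\<integral>x. f x * k x y \<partial>lborel))"
proof -
  have [measurable]: "f \<in> borel_measurable borel" "g \<in> borel_measurable borel"
    using f g by auto
  define H where "H x y = f x * (g y * k x y)" for x y
  have gk: "integrable lborel (\<lambda>y. g y * k x y)" for x
    using g B by (intro integrable_mult_bounded) auto
  have inner: "(\<integral>y. \<bar>g y * k x y\<bar> \<partial>lborel) \<le> (\<integral>y. B * \<bar>g y\<bar> \<partial>lborel)" for x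
  proof (rule integral_mono)
    show "integrable lborel (\<lambda>y. \<bar>g y * k x y\<bar>)"
      using gk by (rule integrable_abs)
    show "integrable lborel (\<lambda>y. B * \<bar>g y\<bar>)"
      using g by (intro integrable_mult_right integrable_abs)
    show "\<bar>g y * k x y\<bar> \<le> B * \<bar>g y\<bar>" for y
      using mult_right_mono[OF B[of x y] abs_ge_zero[of "g y"]]
      by (simp add: abs_mult mult.commute)
  qed
  have Hint: "integrable (lborel \<Otimes>\<^sub>M lborel) (case_prod H)"
    unfolding H_def by (rule integrable_pair_weighted[OF f _ gk inner]) measurable
  have swap: "(\<integral>x. H x y \<partial>lborel) = g y * (\<integral>x. f x * k x y \<partial>lborel)" for y
  proof -
    have "(\<integral>x. H x y \<partial>lborel) = (\<integral>x. g y * (f x * k x y) \<partial>lborel)"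
      unfolding H_def by (intro Bochner_Integration.integral_cong) auto
    then show ?thesis by simp
  qed
  show "integrable lborel (\<lambda>y. g y * (\<integral>x. f x * k x y \<partial>lborel))"
    using lborel_pair.integrable_snd[OF Hint] by (simp add: swap)
  have "(\<integral>x. (\<integral>y. f x * g y * k x y \<partial>lborel) \<partial>lborel) = (\<integral>x. (\<integral>y. H x y \<partial>lborel) \<partial>lborel)"
    by (simp add: H_def mult.assoc)
  also have "\<dots> = (\<integral>y. (\<integral>x. H x y \<partial>lborel) \<partial>lborel)"
    using lborel_pair.Fubini_integral[OF Hint] ..
  finally show "(\<integral>x. (\<integral>y. f x * g y * k x y \<partial>lborel) \<partial>lborel) = (\<integral>y. g y * (\<integral>x. f x * k x y \<partial>lborel) \<partial>lborel)"
    by (simp add: swap)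
qed

lemma borel_measurable_bump_exp [measurable]: "bump_exp k \<in> borel_measurable borel"
  using continuous_on_bump_exp[OF continuous_on_id] by (intro borel_measurable_continuous_onI) auto

lemma mollifier_pair_measurable [measurable]:
  "(\<lambda>(x, y). mollifier e y (x :: real^'n::finite)) \<in> borel_measurable (borel \<Otimes>\<^sub>M borel)"
  unfolding mollifier_def by measurable

lemma partial_mollifier_pair_measurable [measurable]:
  "(\<lambda>(x, y). partials [j] (mollifier e y) (x :: real^'n::finite)) \<in> borel_measurable (borel \<Otimes>\<^sub>M borel)"
proof -
  have [measurable]: "(\<lambda>v :: real^'n. v $ j) \<in> borel_measurable borel"
    by (intro borel_measurable_continuous_onI continuous_intros)
  show ?thesis unfolding partial_mollifier by measurable
qed

lemma abs_mollifier_le_1: "\<bar>mollifier e y x\<bar> \<le> 1"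
  using mollifier_nonneg[of e y x] mollifier_le_1[of e y x] by simp

lemma partial_mollifier_bounded:
  assumes "0 < e"
  obtains B where "\<And>x y :: real^'n::finite. \<bar>partials [j] (mollifier e y) x\<bar> \<le> B"
proof -
  have "test_function UNIV (mollifier e (0 :: real^'n))"
    using assms by (intro test_function_mollifier) auto
  then obtain B where B: "\<And>x :: real^'n. \<bar>partials [j] (mollifier e 0) x\<bar> \<le> B"
    using test_function_bounded[OF test_function_partials] by blast
  have "partials [j] (mollifier e y) x = partials [j] (mollifier e 0) (x - y)" for x y :: "real^'n"
    unfolding partial_mollifier by simp
  with B show ?thesis using that by metis
qed

text \<open>
  The fundamental lemma of the calculus of variations, tested with bumps only. On a compact set \<open>K\<close> the
  doubling of variables is applied to \<open>w\<close>, restricted to a compact neighbourhood of \<open>K\<close>, and to the sign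
  of \<open>w\<close>, restricted to \<open>K\<close>: the diagonal integral is then the integral of \<open>|w|\<close> over \<open>K\<close>.
\<close>

lemma weak_zero_imp_AE_zero:
  fixes w :: "real^'n::finite \<Rightarrow> real"
  assumes \<omega>: "open \<omega>" and w: "locally_integrable \<omega> w"
    and zero: "\<And>e y. 0 < e \<Longrightarrow> cball y e \<subseteq> \<omega> \<Longrightarrow>
      integral\<^sup>L (lebesgue_on \<omega>) (\<lambda>x. w x * mollifier e y x) = 0"
  shows "AE x in lebesgue_on \<omega>. w x = 0"
proof -
  have on_compact: "AE x in lborel. x \<in> K \<longrightarrow> w x = 0" if K: "compact K" "K \<subseteq> \<omega>" for K
  proof -
    obtain r where r: "0 < r" "(\<Union>x\<in>K. cball x r) \<subseteq> \<omega>"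
      using compact_subset_open_imp_cball_epsilon_subset[OF K(1) \<omega> K(2)] by blast
    \<comment> \<open>All bumps of radius less than \<open>r\<close> centred in \<open>K\<close> live on \<open>L\<close>.\<close>
    define L where "L = (\<Union>x\<in>K. cball x r)"
    have L: "compact L" "L \<subseteq> \<omega>" "K \<subseteq> L"
      using compact_thickening[OF K(1)] r by (auto simp: L_def)
    have borel: "L \<in> sets borel" "K \<in> sets borel" "\<omega> \<in> sets borel"
      using L K \<omega> by (auto intro: compact_imp_closed borel_closed)
    have wL: "integrable (lebesgue_on L) w"
      using w L by (simp add: locally_integrable_def)
    obtain W where W: "W \<in> borel_measurable borel" "\<And>x. x \<notin> L \<Longrightarrow> W x = 0"
      "AE x in lebesgue_on L. w x = W x"
      using borel_extension[OF borel(1) borel_measurable_integrable[OF wL]] by blast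
    have W_int: "integrable lborel W"
      using lebesgue_on_eq_lborel(2)[OF borel(1) borel_measurable_integrable[OF wL] W] wL by simp
    define g :: "real^'n \<Rightarrow> real" where "g x = (if 0 \<le> W x then 1 else - 1) * indicator K x" for x
    have g: "g \<in> borel_measurable borel"
    proof -
      note [measurable] = W(1) borel(2)
      show ?thesis unfolding g_def by measurable
    qed
    have g_bound: "\<bar>g x\<bar> \<le> 1" for x
      by (simp add: g_def split: split_indicator)
    obtain R where "K \<subseteq> cball 0 R"
      using bounded_subset_cball_0[OF compact_imp_bounded[OF K(1)]] .
    then have "\<bar>g x\<bar> \<le> 1 * indicator (cball 0 R) x" for x
      by (auto simp: g_def split: split_indicator)
    then have g_int: "integrable lborel g"
      by (rule integrable_bounded_support[OF g])
    have "(\<integral>x. (\<integral>y. W x * g y * mollifier e y x \<partial>lborel) \<partial>lborel) = 0" if e: "0 < e" "e < r" for e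
    proof -
      have g0: "g y * (\<integral>x. W x * mollifier e y x \<partial>lborel) = 0" for y
      proof (cases "y \<in> K")
        case True
        have ball: "cball y e \<subseteq> L"
          using True e by (force simp: L_def)
        have m0: "mollifier e y x = 0" if "x \<notin> L" for x
        proof -
          have "\<not> dist y x \<le> e" using that ball by auto
          then show ?thesis using e by (intro mollifier_zero) (auto simp: dist_commute)
        qed
        have "0 = integral\<^sup>L (lebesgue_on \<omega>) (\<lambda>x. w x * mollifier e y x)"
          using zero[OF e(1)] ball L(2) by auto
        also have "\<dots> = integral\<^sup>L lebesgue (\<lambda>x. indicator \<omega> x *\<^sub>R (w x * mollifier e y x))"
          using borel by (simp add: integral_restrict_space)
        also have "(\<lambda>x. indicator \<omega> x *\<^sub>R (w x * mollifier e y x))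
            = (\<lambda>x. indicator L x *\<^sub>R (w x * mollifier e y x))"
          using m0 L(2) by (force split: split_indicator)
        also have "integral\<^sup>L lebesgue \<dots> = integral\<^sup>L (lebesgue_on L) (\<lambda>x. w x * mollifier e y x)"
          using borel by (simp add: integral_restrict_space)
        also have "\<dots> = (\<integral>x. W x * mollifier e y x \<partial>lborel)"
        proof (rule lebesgue_on_eq_lborel(1)[OF borel(1)])
          show "(\<lambda>x. w x * mollifier e y x) \<in> borel_measurable (lebesgue_on L)"
            by (rule borel_measurable_times[OF borel_measurable_integrable[OF wL]
                  borel_measurable_lebesgue_on[OF borel_measurable_mollifier]])
        qed (use W in auto)
        finally show ?thesis by simp
      qed (simp add: g_def)
      show ?thesis
        unfolding doubled_integral_swap(1)[OF W_int g_int mollifier_pair_measurable abs_mollifier_le_1] g0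
        by simp
    qed
    then have "(\<Sum>i\<in>{()}. \<integral>x. W x * g x \<partial>lborel) = 0"
      using W_int g_int r(1) correlation_tendsto_bounded[OF W_int g g_bound]
      by (intro diagonal_integral_zero) auto
    then have "(\<integral>x. W x * g x \<partial>lborel) = 0" by simp
    moreover have "integrable lborel (\<lambda>x. W x * g x)"
      using integrable_mult_bounded[OF W_int g g_bound] .
    moreover have Wg: "W x * g x = \<bar>W x\<bar> * indicator K x" for x
      by (simp add: g_def)
    ultimately have "AE x in lborel. W x * g x = 0"
      by (subst integral_nonneg_eq_0_iff_AE[symmetric]) auto
    moreover have "AE x in lborel. x \<in> L \<longrightarrow> w x = W x"
      using W(3) borel by (simp add: AE_lebesgue_on_iff)
    ultimately show ?thesis
      by eventually_elim (use L(3) in \<open>auto simp: Wg\<close>)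
  qed
  show ?thesis
  proof (rule open_Union_compact_subsets[OF \<omega>])
    fix C :: "nat \<Rightarrow> (real^'n) set"
    assume C: "\<And>n. compact (C n)" "\<And>n. C n \<subseteq> \<omega>" "\<Union>(range C) = \<omega>"
    have "AE x in lborel. \<forall>n. x \<in> C n \<longrightarrow> w x = 0"
      unfolding AE_all_countable using on_compact C(1,2) by blast
    then have "AE x in lborel. x \<in> \<omega> \<longrightarrow> w x = 0"
      by eventually_elim (use C(3) in blast)
    then show "AE x in lebesgue_on \<omega>. w x = 0"
      using \<omega> by (simp add: AE_lebesgue_on_iff)
  qed
qed

lemma weak_derivative_unique:
  fixes u :: "real^'n::finite \<Rightarrow> real"
  assumes \<omega>: "open \<omega>" and v: "has_weak_derivative \<omega> is u v" and v': "has_weak_derivative \<omega> is u' v'"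
    and u: "AE x in lebesgue_on \<omega>. u x = u' x"
  shows "AE x in lebesgue_on \<omega>. v x = v' x"
proof -
  have loc: "locally_integrable \<omega> u" "locally_integrable \<omega> u'"
    "locally_integrable \<omega> v" "locally_integrable \<omega> v'"
    using v v' by (auto simp: has_weak_derivative_def)
  have "AE x in lebesgue_on \<omega>. v x - v' x = 0"
  proof (rule weak_zero_imp_AE_zero[OF \<omega>])
    show "locally_integrable \<omega> (\<lambda>x. v x - v' x)"
      using loc by (auto simp: locally_integrable_def)
    fix e :: real and y assume "0 < e" "cball y e \<subseteq> \<omega>"
    then have t: "test_function \<omega> (mollifier e y)"
      by (rule test_function_mollifier)
    note t' = test_function_partials[OF t, of "is"]
    have "integral\<^sup>L (lebesgue_on \<omega>) (\<lambda>x. u x * partials is (mollifier e y) x)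
        = integral\<^sup>L (lebesgue_on \<omega>) (\<lambda>x. u' x * partials is (mollifier e y) x)"
    proof (rule integral_cong_AE)
      show "AE x in lebesgue_on \<omega>. u x * partials is (mollifier e y) x = u' x * partials is (mollifier e y) x"
        using u by eventually_elim simp
    qed (intro borel_measurable_integrable locally_integrable_test_integrable[OF \<omega> _ t'] loc)+
    then have "integral\<^sup>L (lebesgue_on \<omega>) (\<lambda>x. v x * mollifier e y x)
        = integral\<^sup>L (lebesgue_on \<omega>) (\<lambda>x. v' x * mollifier e y x)"
      using v v' t by (simp add: has_weak_derivative_def)
    then show "integral\<^sup>L (lebesgue_on \<omega>) (\<lambda>x. (v x - v' x) * mollifier e y x) = 0"
      using locally_integrable_test_integrable[OF \<omega> loc(3) t] locally_integrable_test_integrable[OF \<omega> loc(4) t]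
      by (simp add: left_diff_distrib)
  qed
  then show ?thesis by eventually_elim simp
qed

section \<open>Calculus of weak derivatives\<close>

text \<open>
  With \<open>m\<close> the bump in \<open>x - y\<close>, the three terms of the claim are doubled to integrals of
  \<open>U \<partial>\<phi> (x) V (y) m\<close>, \<open>U' \<phi> (x) V (y) m\<close> and \<open>U \<phi> (x) V' (y) m\<close>. For fixed \<open>y\<close> the function \<open>\<phi> m\<close> is a test
  function of \<open>x\<close>, which turns the first two terms into \<open>- U \<phi> (x) V (y) \<partial>m\<close>. For fixed \<open>x\<close> in the support
  of \<open>\<phi>\<close> the bump is a test function of \<open>y\<close>, and antisymmetry of its derivative turns the third term
  into the opposite expression.
\<close>

lemma weak_product_rule_borel:
  fixes U V U' V' \<phi> :: "real^'n::finite \<Rightarrow> real"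
  assumes \<omega>: "open \<omega>"
    and L2: "L2_fun U" "L2_fun V" "L2_fun U'" "L2_fun V'"
    and L1: "integrable lborel U" "integrable lborel V" "integrable lborel U'" "integrable lborel V'"
    and wU: "\<And>\<phi>. test_function \<omega> \<phi> \<Longrightarrow> (\<integral>x. U x * partials [j] \<phi> x \<partial>lborel) = - (\<integral>x. U' x * \<phi> x \<partial>lborel)"
    and wV: "\<And>\<phi>. test_function \<omega> \<phi> \<Longrightarrow> (\<integral>x. V x * partials [j] \<phi> x \<partial>lborel) = - (\<integral>x. V' x * \<phi> x \<partial>lborel)"
    and \<phi>: "test_function \<omega> \<phi>"
  shows "(\<integral>x. U x * V x * partials [j] \<phi> x \<partial>lborel) = - (\<integral>x. (U' x * V x + U x * V' x) * \<phi> x \<partial>lborel)"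
proof -
  obtain K where K: "compact K" "K \<subseteq> \<omega>" and \<phi>K: "\<And>x. x \<notin> K \<Longrightarrow> \<phi> x = 0"
    using test_function_support[OF \<phi>] by metis
  obtain r where r: "0 < r" "(\<Union>x\<in>K. cball x r) \<subseteq> \<omega>"
    using compact_subset_open_imp_cball_epsilon_subset[OF K(1) \<omega> K(2)] by blast
  define \<phi>' where "\<phi>' = partials [j] \<phi>"
  have \<phi>': "test_function \<omega> \<phi>'" unfolding \<phi>'_def by (rule test_function_partials[OF \<phi>])
  obtain b where b: "\<And>x. \<bar>\<phi> x\<bar> \<le> b" using test_function_bounded[OF \<phi>] by blast
  obtain b' where b': "\<And>x. \<bar>\<phi>' x\<bar> \<le> b'" using test_function_bounded[OF \<phi>'] by blast
  note meas [measurable] = test_function_measurable[OF \<phi>] test_function_measurable[OF \<phi>']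
  have int: "integrable lborel (\<lambda>x. U x * \<phi>' x)" "integrable lborel (\<lambda>x. U' x * \<phi> x)"
    "integrable lborel (\<lambda>x. U x * \<phi> x)"
    using L1 b b' by (auto intro!: integrable_mult_bounded)
  have L2_mult: "L2_fun (\<lambda>x. f x * h x)"
    if f: "L2_fun f" and [measurable]: "h \<in> borel_measurable borel" and c: "\<And>x. \<bar>h x\<bar> \<le> c"
    for f h :: "real^'n \<Rightarrow> real" and c
  proof -
    have "\<bar>(h x)\<^sup>2\<bar> \<le> c\<^sup>2" for x
      using c[of x] by (metis abs_ge_zero power2_abs power_mono abs_power2)
    then have "integrable lborel (\<lambda>x. (f x)\<^sup>2 * (h x)\<^sup>2)"
      using f by (intro integrable_mult_bounded) (auto simp: L2_fun_def)
    moreover have [measurable]: "f \<in> borel_measurable borel"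
      using f by (simp add: L2_fun_def)
    ultimately show ?thesis by (simp add: L2_fun_def power_mult_distrib)
  qed
  define F where "F i = (if i = 0 then (\<lambda>x. U x * \<phi>' x) else if i = 1 then (\<lambda>x. U' x * \<phi> x)
    else (\<lambda>x. U x * \<phi> x))" for i :: nat
  define G where "G i = (if i = 2 then V' else V)" for i :: nat
  have "(\<Sum>i\<in>{0::nat, 1, 2}. \<integral>x. F i x * G i x \<partial>lborel) = 0"
  proof (rule diagonal_integral_zero)
    show "integrable lborel (F i)"
      "integrable lborel (G i)" if "i \<in> {0, 1, 2}" for i
      using that int L1 by (auto simp: F_def G_def)
    show "(correlation (F i) (G i) \<longlongrightarrow>
        correlation (F i) (G i) 0) (at 0)"
      if "i \<in> {0, 1, 2}" for i
      by (rule correlation_tendsto_L2)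
        (use L2 L2_mult[OF _ meas(1) b] L2_mult[OF _ meas(2) b'] in \<open>simp_all add: F_def G_def\<close>)
    show "0 < r" by fact
    fix e assume e: "0 < e" "e < r"
    define m where "m x y = mollifier e y x" for x y :: "real^'n"
    define m' where "m' x y = partials [j] (mollifier e y) x" for x y :: "real^'n"
    have m: "case_prod m \<in> borel_measurable (borel \<Otimes>\<^sub>M borel)" "\<And>x y. \<bar>m x y\<bar> \<le> 1"
      unfolding m_def by (auto simp: abs_mollifier_le_1)
    obtain c where c: "\<And>x y. \<bar>m' x y\<bar> \<le> c"
      unfolding m'_def using partial_mollifier_bounded[OF e(1)] by blast
    have m': "case_prod m' \<in> borel_measurable (borel \<Otimes>\<^sub>M borel)"
      unfolding m'_def by measurable
    have [measurable]: "(\<lambda>x. m x y) \<in> borel_measurable borel" "(\<lambda>x. m' x y) \<in> borel_measurable borel" for y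
      using m(1) m' by measurable
    have inner_x: "(\<integral>x. U x * \<phi>' x * m x y \<partial>lborel) + (\<integral>x. U' x * \<phi> x * m x y \<partial>lborel)
        = - (\<integral>x. U x * \<phi> x * m' x y \<partial>lborel)" for y
    proof -
      have "partials [j] (\<lambda>x. \<phi> x * mollifier e y x) x = \<phi> x * m' x y + \<phi>' x * m x y" for x
        unfolding m_def m'_def \<phi>'_def
        by (rule partials_mult[OF test_function_smooth[OF \<phi>] smooth_mollifier])
      then have "- (\<integral>x. U' x * (\<phi> x * m x y) \<partial>lborel) = (\<integral>x. U x * (\<phi> x * m' x y + \<phi>' x * m x y) \<partial>lborel)"
        using wU[OF test_function_mult[OF \<phi> smooth_mollifier[of e y]]] by (simp add: m_def del: partials.simps)
      also have "\<dots> = (\<integral>x. U x * \<phi> x * m' x y + U x * \<phi>' x * m x y \<partial>lborel)"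
        by (simp add: algebra_simps)
      also have "\<dots> = (\<integral>x. U x * \<phi> x * m' x y \<partial>lborel) + (\<integral>x. U x * \<phi>' x * m x y \<partial>lborel)"
        by (intro Bochner_Integration.integral_add integrable_mult_bounded[OF int(3) _ c]
            integrable_mult_bounded[OF int(1) _ m(2)]) measurable
      finally show ?thesis by (simp add: mult.assoc)
    qed
    have inner_y: "\<phi> x * (\<integral>y. V' y * m x y \<partial>lborel) = \<phi> x * (\<integral>y. V y * m' x y \<partial>lborel)" for x
    proof (cases "x \<in> K")
      case True
      then have "cball x e \<subseteq> \<omega>"
        using r(2) e by (force simp: subset_iff)
      then have "test_function \<omega> (mollifier e x)"
        using e by (intro test_function_mollifier) auto
      from wV[OF this] show ?thesis
        unfolding m_def m'_def partial_mollifier_antisym[of j e _ x] mollifier_sym[of e _ x] by simp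
    qed (simp add: \<phi>K)
    have "(\<integral>x. (\<integral>y. U x * \<phi> x * V' y * m x y \<partial>lborel) \<partial>lborel)
        = (\<integral>x. U x * (\<phi> x * (\<integral>y. V' y * m x y \<partial>lborel)) \<partial>lborel)"
      by (simp add: mult.assoc)
    also have "\<dots> = (\<integral>x. (\<integral>y. U x * \<phi> x * V y * m' x y \<partial>lborel) \<partial>lborel)"
      unfolding inner_y by (simp add: mult.assoc)
    also have "\<dots> = (\<integral>y. V y * (\<integral>x. U x * \<phi> x * m' x y \<partial>lborel) \<partial>lborel)"
      by (rule doubled_integral_swap(1)[OF int(3) L1(2) m' c])
    finally have T2: "(\<integral>x. (\<integral>y. U x * \<phi> x * V' y * m x y \<partial>lborel) \<partial>lborel)
        = (\<integral>y. V y * (\<integral>x. U x * \<phi> x * m' x y \<partial>lborel) \<partial>lborel)" .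
    have "(\<integral>x. (\<integral>y. U x * \<phi>' x * V y * m x y \<partial>lborel) \<partial>lborel)
        + (\<integral>x. (\<integral>y. U' x * \<phi> x * V y * m x y \<partial>lborel) \<partial>lborel)
        = (\<integral>y. V y * (\<integral>x. U x * \<phi>' x * m x y \<partial>lborel) \<partial>lborel)
        + (\<integral>y. V y * (\<integral>x. U' x * \<phi> x * m x y \<partial>lborel) \<partial>lborel)"
      using doubled_integral_swap(1)[OF int(1) L1(2) m] doubled_integral_swap(1)[OF int(2) L1(2) m] by simp
    also have "\<dots> = (\<integral>y. V y * ((\<integral>x. U x * \<phi>' x * m x y \<partial>lborel) + (\<integral>x. U' x * \<phi> x * m x y \<partial>lborel)) \<partial>lborel)"
      using doubled_integral_swap(2)[OF int(1) L1(2) m] doubled_integral_swap(2)[OF int(2) L1(2) m]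
      by (simp add: distrib_left)
    also have "\<dots> = - (\<integral>y. V y * (\<integral>x. U x * \<phi> x * m' x y \<partial>lborel) \<partial>lborel)"
      unfolding inner_x by simp
    finally show "(\<Sum>i\<in>{0, 1, 2}. \<integral>x. (\<integral>y. F i x
        * G i y * mollifier e y x \<partial>lborel) \<partial>lborel) = 0"
      using T2 by (simp add: F_def G_def m_def)
  qed
  then have "(\<integral>x. U x * \<phi>' x * V x \<partial>lborel) + ((\<integral>x. U' x * \<phi> x * V x \<partial>lborel) + (\<integral>x. U x * \<phi> x * V' x \<partial>lborel)) = 0"
    by (simp add: F_def G_def)
  moreover have "(\<integral>x. (U' x * V x + U x * V' x) * \<phi> x \<partial>lborel)
      = (\<integral>x. U' x * \<phi> x * V x \<partial>lborel) + (\<integral>x. U x * \<phi> x * V' x \<partial>lborel)"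
  proof -
    have "(\<integral>x. (U' x * V x + U x * V' x) * \<phi> x \<partial>lborel) = (\<integral>x. U' x * \<phi> x * V x + U x * \<phi> x * V' x \<partial>lborel)"
      by (simp add: algebra_simps)
    also have "\<dots> = (\<integral>x. U' x * \<phi> x * V x \<partial>lborel) + (\<integral>x. U x * \<phi> x * V' x \<partial>lborel)"
      using L2 L2_mult[OF _ meas(1) b] by (intro Bochner_Integration.integral_add L2_mult_integrable) auto
    finally show ?thesis .
  qed
  moreover have "(\<lambda>x. U x * V x * partials [j] \<phi> x) = (\<lambda>x. U x * \<phi>' x * V x)"
    by (simp add: \<phi>'_def mult_ac)
  ultimately show ?thesis by simp
qed

lemma square_integrable_on_mult:
  assumes "square_integrable_on \<omega> u" "square_integrable_on \<omega> v"
  shows "integrable (lebesgue_on \<omega>) (\<lambda>x. u x * v x)"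
proof (rule Bochner_Integration.integrable_bound)
  show "integrable (lebesgue_on \<omega>) (\<lambda>x. (u x)\<^sup>2 + (v x)\<^sup>2)"
    using assms by (auto simp: square_integrable_on_def)
  show "(\<lambda>x. u x * v x) \<in> borel_measurable (lebesgue_on \<omega>)"
    using assms by (auto simp: square_integrable_on_def)
  show "AE x in lebesgue_on \<omega>. norm (u x * v x) \<le> norm ((u x)\<^sup>2 + (v x)\<^sup>2)"
    using abs_mult_le_sum_squares by (intro AE_I2) simp
qed

lemma integrable_imp_locally_integrable:
  assumes "open \<omega>" "integrable (lebesgue_on \<omega>) u"
  shows "locally_integrable \<omega> u"
  unfolding locally_integrable_def
proof (intro allI impI)
  fix K assume K: "compact K \<and> K \<subseteq> \<omega>"
  then show "integrable (lebesgue_on K) u"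
    using assms by (intro integrable_lebesgue_on_subset[OF assms(2)]) (auto simp: compact_imp_closed)
qed

lemma L2_extension:
  fixes u :: "real^'n::finite \<Rightarrow> real"
  assumes \<omega>: "open \<omega>" "bounded \<omega>" and u: "square_integrable_on \<omega> u"
  obtains U where "L2_fun U" "integrable lborel U" "\<And>x. x \<notin> \<omega> \<Longrightarrow> U x = 0"
    "AE x in lebesgue_on \<omega>. u x = U x"
proof -
  have \<omega>b: "\<omega> \<in> sets borel" using \<omega> by simp
  have um: "u \<in> borel_measurable (lebesgue_on \<omega>)"
    and u2: "integrable (lebesgue_on \<omega>) (\<lambda>x. (u x)\<^sup>2)"
    using u by (auto simp: square_integrable_on_def)
  obtain U where U: "U \<in> borel_measurable borel" "\<And>x. x \<notin> \<omega> \<Longrightarrow> U x = 0"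
    "AE x in lebesgue_on \<omega>. u x = U x"
    using borel_extension[OF \<omega>b um] by blast
  have "integrable (lebesgue_on \<omega>) (\<lambda>x. (u x)\<^sup>2) \<longleftrightarrow> integrable lborel (\<lambda>x. (U x)\<^sup>2)"
  proof (rule lebesgue_on_eq_lborel(2)[OF \<omega>b])
    show "AE x in lebesgue_on \<omega>. (u x)\<^sup>2 = (U x)\<^sup>2"
      using U(3) by eventually_elim simp
  qed (use um U in auto)
  then have U2: "integrable lborel (\<lambda>x. (U x)\<^sup>2)" using u2 by simp
  obtain R where R: "\<omega> \<subseteq> cball 0 R"
    using bounded_subset_cball_0[OF \<omega>(2)] .
  have "integrable lborel U"
  proof (rule Bochner_Integration.integrable_bound)
    show "integrable lborel (\<lambda>x. (U x)\<^sup>2 + indicator (cball 0 R) x)"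
      using U2 by (intro Bochner_Integration.integrable_add integrable_indicator_cball)
    have "\<bar>U x\<bar> \<le> (U x)\<^sup>2 + indicator (cball 0 R) x" for x
    proof (cases "x \<in> \<omega>")
      case True
      then have "indicat_real (cball 0 R) x = 1" using R by auto
      then show ?thesis
        using abs_mult_le_sum_squares[of "U x" 1] by simp
    qed (simp add: U(2))
    then show "AE x in lborel. norm (U x) \<le> norm ((U x)\<^sup>2 + indicator (cball 0 R) x)"
      by (intro AE_I2) (metis abs_ge_self order_trans real_norm_def)
  qed (use U in auto)
  with U U2 that show ?thesis by (simp add: L2_fun_def)
qed

lemma weak_product_rule:
  fixes u v u' v' :: "real^'n::finite \<Rightarrow> real"
  assumes \<omega>: "open \<omega>" "bounded \<omega>"
    and L2: "square_integrable_on \<omega> u" "square_integrable_on \<omega> v"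
      "square_integrable_on \<omega> u'" "square_integrable_on \<omega> v'"
    and wu: "has_weak_derivative \<omega> [j] u u'" and wv: "has_weak_derivative \<omega> [j] v v'"
  shows "has_weak_derivative \<omega> [j] (\<lambda>x. u x * v x) (\<lambda>x. u' x * v x + u x * v' x)"
  unfolding has_weak_derivative_def
proof (intro conjI allI impI)
  show "locally_integrable \<omega> (\<lambda>x. u x * v x)"
    using \<omega> L2 by (intro integrable_imp_locally_integrable square_integrable_on_mult)
  show "locally_integrable \<omega> (\<lambda>x. u' x * v x + u x * v' x)"
    using \<omega> L2 by (intro integrable_imp_locally_integrable Bochner_Integration.integrable_add
        square_integrable_on_mult)
  have \<omega>b: "\<omega> \<in> sets borel" using \<omega> by simp
  have meas: "u \<in> borel_measurable (lebesgue_on \<omega>)" "v \<in> borel_measurable (lebesgue_on \<omega>)"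
    "u' \<in> borel_measurable (lebesgue_on \<omega>)" "v' \<in> borel_measurable (lebesgue_on \<omega>)"
    using L2 by (auto simp: square_integrable_on_def)
  obtain U where U: "L2_fun U" "integrable lborel U" "\<And>x. x \<notin> \<omega> \<Longrightarrow> U x = 0"
    "AE x in lebesgue_on \<omega>. u x = U x" using L2_extension[OF \<omega> L2(1)] by blast
  obtain V where V: "L2_fun V" "integrable lborel V" "\<And>x. x \<notin> \<omega> \<Longrightarrow> V x = 0"
    "AE x in lebesgue_on \<omega>. v x = V x" using L2_extension[OF \<omega> L2(2)] by blast
  obtain U' where U': "L2_fun U'" "integrable lborel U'" "\<And>x. x \<notin> \<omega> \<Longrightarrow> U' x = 0"
    "AE x in lebesgue_on \<omega>. u' x = U' x" using L2_extension[OF \<omega> L2(3)] by blast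
  obtain V' where V': "L2_fun V'" "integrable lborel V'" "\<And>x. x \<notin> \<omega> \<Longrightarrow> V' x = 0"
    "AE x in lebesgue_on \<omega>. v' x = V' x" using L2_extension[OF \<omega> L2(4)] by blast
  have [measurable]: "U \<in> borel_measurable borel" "V \<in> borel_measurable borel"
    "U' \<in> borel_measurable borel" "V' \<in> borel_measurable borel"
    using U V U' V' by (simp_all add: L2_fun_def)
  have transfer: "integral\<^sup>L (lebesgue_on \<omega>) (\<lambda>x. w x * \<phi> x) = (\<integral>x. W x * \<phi> x \<partial>lborel)"
    if "w \<in> borel_measurable (lebesgue_on \<omega>)" "W \<in> borel_measurable borel" "\<And>x. x \<notin> \<omega> \<Longrightarrow> W x = 0"
      "AE x in lebesgue_on \<omega>. w x = W x" "\<phi> \<in> borel_measurable borel"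
    for w W \<phi> :: "real^'n \<Rightarrow> real"
  proof (rule lebesgue_on_eq_lborel(1)[OF \<omega>b])
    show "(\<lambda>x. w x * \<phi> x) \<in> borel_measurable (lebesgue_on \<omega>)"
      by (rule borel_measurable_times[OF that(1) borel_measurable_lebesgue_on[OF that(5)]])
    show "AE x in lebesgue_on \<omega>. w x * \<phi> x = W x * \<phi> x"
      using that(4) by eventually_elim simp
  qed (use that in auto)
  fix \<phi> assume \<phi>: "test_function \<omega> \<phi>"
  have t: "\<psi> \<in> borel_measurable borel" "partials [j] \<psi> \<in> borel_measurable borel"
    if "test_function \<omega> \<psi>" for \<psi>
    using that test_function_measurable test_function_partials by blast+
  have "integral\<^sup>L (lebesgue_on \<omega>) (\<lambda>x. u x * v x * partials [j] \<phi> x)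
      = (\<integral>x. U x * V x * partials [j] \<phi> x \<partial>lborel)"
  proof (rule transfer)
    show "AE x in lebesgue_on \<omega>. u x * v x = U x * V x"
      using U(4) V(4) by eventually_elim simp
  qed (use meas U(3) t(2)[OF \<phi>] in \<open>auto simp del: partials.simps\<close>)
  also have "\<dots> = - (\<integral>x. (U' x * V x + U x * V' x) * \<phi> x \<partial>lborel)"
  proof (rule weak_product_rule_borel[OF \<omega>(1)])
    fix \<psi> assume \<psi>: "test_function \<omega> \<psi>"
    show "(\<integral>x. U x * partials [j] \<psi> x \<partial>lborel) = - (\<integral>x. U' x * \<psi> x \<partial>lborel)"
      using wu \<psi> transfer[OF meas(1) _ U(3,4) t(2)[OF \<psi>]] transfer[OF meas(3) _ U'(3,4) t(1)[OF \<psi>]]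
      by (simp add: has_weak_derivative_def del: partials.simps)
    show "(\<integral>x. V x * partials [j] \<psi> x \<partial>lborel) = - (\<integral>x. V' x * \<psi> x \<partial>lborel)"
      using wv \<psi> transfer[OF meas(2) _ V(3,4) t(2)[OF \<psi>]] transfer[OF meas(4) _ V'(3,4) t(1)[OF \<psi>]]
      by (simp add: has_weak_derivative_def del: partials.simps)
  qed (use U V U' V' \<phi> in auto)
  also have "(\<integral>x. (U' x * V x + U x * V' x) * \<phi> x \<partial>lborel)
      = integral\<^sup>L (lebesgue_on \<omega>) (\<lambda>x. (u' x * v x + u x * v' x) * \<phi> x)"
  proof (rule transfer[symmetric])
    show "AE x in lebesgue_on \<omega>. u' x * v x + u x * v' x = U' x * V x + U x * V' x"
      using U(4) V(4) U'(4) V'(4) by eventually_elim simp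
  qed (use meas U(3) V(3) t(1)[OF \<phi>] in auto)
  finally show "integral\<^sup>L (lebesgue_on \<omega>) (\<lambda>x. u x * v x * partials [j] \<phi> x)
      = (- 1) ^ length [j] * integral\<^sup>L (lebesgue_on \<omega>) (\<lambda>x. (u' x * v x + u x * v' x) * \<phi> x)"
    by (simp del: partials.simps)
qed

lemma has_weak_derivativeD:
  assumes "has_weak_derivative \<omega> is u v" "test_function \<omega> \<phi>"
  shows "integral\<^sup>L (lebesgue_on \<omega>) (\<lambda>x. u x * partials is \<phi> x)
    = (- 1) ^ length is * integral\<^sup>L (lebesgue_on \<omega>) (\<lambda>x. v x * \<phi> x)"
  using assms by (simp add: has_weak_derivative_def)

lemma has_weak_derivative_sum:
  assumes \<omega>: "open \<omega>" and w: "\<And>i. i \<in> I \<Longrightarrow> has_weak_derivative \<omega> is (u i) (v i)"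
  shows "has_weak_derivative \<omega> is (\<lambda>x. \<Sum>i\<in>I. u i x) (\<lambda>x. \<Sum>i\<in>I. v i x)"
proof -
  have loc: "locally_integrable \<omega> (u i)" "locally_integrable \<omega> (v i)" if "i \<in> I" for i
    using w[OF that] by (auto simp: has_weak_derivative_def)
  show ?thesis
    unfolding has_weak_derivative_def
  proof (intro conjI allI impI)
    show "locally_integrable \<omega> (\<lambda>x. \<Sum>i\<in>I. u i x)" "locally_integrable \<omega> (\<lambda>x. \<Sum>i\<in>I. v i x)"
      using loc by (auto simp: locally_integrable_def intro!: Bochner_Integration.integrable_sum)
    fix \<phi> assume \<phi>: "test_function \<omega> \<phi>"
    have "integral\<^sup>L (lebesgue_on \<omega>) (\<lambda>x. (\<Sum>i\<in>I. u i x) * partials is \<phi> x)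
        = (\<Sum>i\<in>I. integral\<^sup>L (lebesgue_on \<omega>) (\<lambda>x. u i x * partials is \<phi> x))"
      unfolding sum_distrib_right
      by (intro Bochner_Integration.integral_sum locally_integrable_test_integrable[OF \<omega>]
          test_function_partials \<phi> loc)
    also have "\<dots> = (\<Sum>i\<in>I. (- 1) ^ length is * integral\<^sup>L (lebesgue_on \<omega>) (\<lambda>x. v i x * \<phi> x))"
      using w \<phi> by (intro sum.cong) (auto simp: has_weak_derivative_def)
    also have "\<dots> = (- 1) ^ length is * integral\<^sup>L (lebesgue_on \<omega>) (\<lambda>x. (\<Sum>i\<in>I. v i x) * \<phi> x)"
      unfolding sum_distrib_right sum_distrib_left[symmetric]
      by (subst Bochner_Integration.integral_sum)
        (auto intro: locally_integrable_test_integrable[OF \<omega> _ \<phi>] loc)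
    finally show "integral\<^sup>L (lebesgue_on \<omega>) (\<lambda>x. (\<Sum>i\<in>I. u i x) * partials is \<phi> x)
        = (- 1) ^ length is * integral\<^sup>L (lebesgue_on \<omega>) (\<lambda>x. (\<Sum>i\<in>I. v i x) * \<phi> x)" .
  qed
qed

text \<open>
  The list \<open>[i, j]\<close> differentiates the test function in direction \<open>j\<close> first, so the equation for \<open>p\<close> is
  applied to the \<open>j\<close>-th partial derivative of the test function.
\<close>

lemma has_weak_derivative_iterated:
  assumes p: "has_weak_derivative \<omega> [i] u p" and h: "has_weak_derivative \<omega> [i, j] u h"
  shows "has_weak_derivative \<omega> [j] p h"
  unfolding has_weak_derivative_def
proof (intro conjI allI impI)
  fix \<phi> assume \<phi>: "test_function \<omega> \<phi>"
  have eq: "partials [i, j] \<phi> = partials [i] (partials [j] \<phi>)" by simp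
  have "- integral\<^sup>L (lebesgue_on \<omega>) (\<lambda>x. p x * partials [j] \<phi> x)
      = integral\<^sup>L (lebesgue_on \<omega>) (\<lambda>x. u x * partials [i, j] \<phi> x)"
    unfolding eq using has_weak_derivativeD[OF p test_function_partials[OF \<phi>, of "[j]"]]
    by (simp del: partials.simps)
  also have "\<dots> = integral\<^sup>L (lebesgue_on \<omega>) (\<lambda>x. h x * \<phi> x)"
    using has_weak_derivativeD[OF h \<phi>] by (simp del: partials.simps)
  finally show "integral\<^sup>L (lebesgue_on \<omega>) (\<lambda>x. p x * partials [j] \<phi> x)
      = (- 1) ^ length [j] * integral\<^sup>L (lebesgue_on \<omega>) (\<lambda>x. h x * \<phi> x)"
    by (simp del: partials.simps)
qed (use p h in \<open>auto simp: has_weak_derivative_def\<close>)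

text \<open>
  Both derivatives give the same result when tested with a bump, whose mixed partial derivatives
  commute.
\<close>

lemma weak_mixed_derivatives_symmetric:
  fixes u :: "real^'n::finite \<Rightarrow> real"
  assumes \<omega>: "open \<omega>" and h: "has_weak_derivative \<omega> [i, j] u h" and h': "has_weak_derivative \<omega> [j, i] u h'"
  shows "AE x in lebesgue_on \<omega>. h x = h' x"
proof -
  have loc: "locally_integrable \<omega> h" "locally_integrable \<omega> h'"
    using h h' by (auto simp: has_weak_derivative_def)
  have "AE x in lebesgue_on \<omega>. h x - h' x = 0"
  proof (rule weak_zero_imp_AE_zero[OF \<omega>])
    show "locally_integrable \<omega> (\<lambda>x. h x - h' x)"
      using loc by (auto simp: locally_integrable_def)
    fix e :: real and y assume "0 < e" "cball y e \<subseteq> \<omega>"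
    then have t: "test_function \<omega> (mollifier e y)"
      by (rule test_function_mollifier)
    have eq: "partials [i, j] (mollifier e y) = partials [j, i] (mollifier e y)"
      using mollifier_mixed_partials by blast
    have "integral\<^sup>L (lebesgue_on \<omega>) (\<lambda>x. h x * mollifier e y x)
        = integral\<^sup>L (lebesgue_on \<omega>) (\<lambda>x. h' x * mollifier e y x)"
      using has_weak_derivativeD[OF h t] has_weak_derivativeD[OF h' t] unfolding eq
      by (simp del: partials.simps)
    then show "integral\<^sup>L (lebesgue_on \<omega>) (\<lambda>x. (h x - h' x) * mollifier e y x) = 0"
      using locally_integrable_test_integrable[OF \<omega> loc(1) t] locally_integrable_test_integrable[OF \<omega> loc(2) t]
      by (simp add: left_diff_distrib)
  qed
  then show ?thesis by eventually_elim simp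
qed

text \<open>
  The difference quotients of \<open>F\<close> in direction \<open>e\<close> have integral zero by translation invariance. They
  converge to the derivative and are dominated thanks to the mean value theorem.
\<close>

lemma integral_directional_derivative_zero:
  fixes F :: "'a::euclidean_space \<Rightarrow> real"
  assumes D: "\<And>x. (F has_derivative D x) (at x)" and e: "norm e \<le> 1"
    and B: "\<And>x. \<bar>D x e\<bar> \<le> B" and R: "\<And>x. norm x > R \<Longrightarrow> F x = 0"
  shows "(\<integral>x. D x e \<partial>lborel) = 0"
proof -
  have contF: "continuous_on UNIV F"
    by (intro continuous_at_imp_continuous_on ballI has_derivative_continuous[OF D])
  then have [measurable]: "F \<in> borel_measurable borel"
    by (rule borel_measurable_continuous_onI)
  have along: "((\<lambda>s. F (x + s *\<^sub>R e)) has_real_derivative D (x + s *\<^sub>R e) e) (at s)" for x s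
  proof -
    have "((\<lambda>s. x + s *\<^sub>R e) has_derivative (\<lambda>h. h *\<^sub>R e)) (at s)"
      by (auto intro!: derivative_eq_intros)
    from has_derivative_compose[OF this D]
    have "((\<lambda>s. F (x + s *\<^sub>R e)) has_derivative (\<lambda>h. D (x + s *\<^sub>R e) (h *\<^sub>R e))) (at s)" .
    moreover have "D y (h *\<^sub>R e) = D y e * h" for y h
      using linear_scale[OF has_derivative_linear[OF D]] by simp
    ultimately show ?thesis
      by (simp add: has_field_derivative_def mult_commute_abs)
  qed
  define t where "t n = 1 / real (Suc n)" for n
  have t: "0 < t n" "t n \<le> 1" for n by (simp_all add: t_def)
  define q where "q n x = (F (x + t n *\<^sub>R e) - F x) / t n" for n x
  have [measurable]: "q n \<in> borel_measurable borel" for n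
    unfolding q_def[abs_def] by measurable
  have q_lim: "(\<lambda>n. q n x) \<longlonglongrightarrow> D x e" for x
  proof -
    have lim0: "((\<lambda>h. (F (x + h *\<^sub>R e) - F x) / h) \<longlongrightarrow> D x e) (at 0)"
      using along[of x 0] by (simp add: DERIV_def)
    have "filterlim t (at 0) sequentially"
      unfolding t_def filterlim_at using LIMSEQ_inverse_real_of_nat by (simp add: inverse_eq_divide)
    from filterlim_compose[OF lim0 this] show ?thesis by (simp add: q_def)
  qed
  have [measurable]: "(\<lambda>x. D x e) \<in> borel_measurable borel"
    by (rule borel_measurable_LIMSEQ_real[OF q_lim]) measurable
  have q_bound: "\<bar>q n x\<bar> \<le> B * indicator (cball 0 (R + 1)) x" for n x
  proof (cases "norm x \<le> R + 1")
    case True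
    obtain z where "F (x + t n *\<^sub>R e) - F (x + 0 *\<^sub>R e) = (t n - 0) * D (x + z *\<^sub>R e) e"
      using MVT2[of 0 "t n" "\<lambda>s. F (x + s *\<^sub>R e)" "\<lambda>s. D (x + s *\<^sub>R e) e"] along t by blast
    then have "q n x = D (x + z *\<^sub>R e) e"
      using t[of n] by (simp add: q_def)
    with True B show ?thesis by simp
  next
    case False
    have "norm (t n *\<^sub>R e) \<le> 1"
      using mult_mono[OF t(2)[of n] e] t(1)[of n] by simp
    then have "norm (x + t n *\<^sub>R e) > R"
      using norm_triangle_ineq4[of "x + t n *\<^sub>R e" "t n *\<^sub>R e"] False by simp
    with False show ?thesis by (simp add: q_def R)
  qed
  have intF: "integrable lborel F"
  proof -
    have "compact (F ` cball 0 R)"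
      by (intro compact_continuous_image continuous_on_subset[OF contF]) auto
    then obtain M where "\<forall>y\<in>F ` cball 0 R. norm y \<le> M"
      using compact_imp_bounded bounded_iff by blast
    then have "\<bar>F x\<bar> \<le> M * indicator (cball 0 R) x" for x
      using R[of x] by (cases "norm x \<le> R") auto
    then show ?thesis
      by (intro integrable_bounded_support) auto
  qed
  have "(\<integral>x. q n x \<partial>lborel) = 0" for n
  proof -
    have "integrable lborel (\<lambda>x. F (x + t n *\<^sub>R e))"
      using intF by (simp add: integral_lborel_translate(2))
    then have "(\<integral>x. q n x \<partial>lborel) = ((\<integral>x. F (x + t n *\<^sub>R e) \<partial>lborel) - (\<integral>x. F x \<partial>lborel)) / t n"
      using intF by (simp add: q_def)
    then show ?thesis by (simp add: integral_lborel_translate(1))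
  qed
  moreover have "(\<lambda>n. \<integral>x. q n x \<partial>lborel) \<longlonglongrightarrow> (\<integral>x. D x e \<partial>lborel)"
  proof (rule integral_dominated_convergence)
    show "integrable lborel (\<lambda>x. B * indicator (cball 0 (R + 1)) x :: real)"
      by (intro integrable_mult_right integrable_indicator_cball)
    show "AE x in lborel. norm (q n x) \<le> B * indicator (cball 0 (R + 1)) x" for n
      using q_bound by simp
  qed (use q_lim in auto)
  ultimately show ?thesis
    by (simp add: LIMSEQ_const_iff)
qed

text \<open>
  Integration by parts: the product \<open>f * \<phi>\<close>, extended by zero, is differentiable on the whole space with
  compact support, so the integral of its partial derivative vanishes.
\<close>

lemma continuously_differentiable_has_weak_derivative:
  fixes f :: "real^'n::finite \<Rightarrow> real" and G :: "real^'n \<Rightarrow> real^'n"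
  assumes \<omega>: "open \<omega>" and D: "\<And>x. x \<in> \<omega> \<Longrightarrow> (f has_derivative (\<lambda>h. G x \<bullet> h)) (at x)"
    and G: "continuous_on \<omega> G"
  shows "has_weak_derivative \<omega> [j] f (\<lambda>x. G x $ j)"
proof -
  have f: "continuous_on \<omega> f"
    using D has_derivative_continuous by (blast intro: continuous_at_imp_continuous_on)
  have Gj: "continuous_on \<omega> (\<lambda>x. G x $ j)"
    by (intro continuous_intros G)
  have loc: "locally_integrable \<omega> g" if "continuous_on \<omega> g" for g :: "real^'n \<Rightarrow> real"
    unfolding locally_integrable_def
  proof (intro allI impI)
    fix K assume K: "compact K \<and> K \<subseteq> \<omega>"
    then have "integrable lborel (\<lambda>x. indicator K x *\<^sub>R g x)"
      using borel_integrable_compact[of K g] continuous_on_subset[OF that] by (auto simp: mult.commute)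
    then have "integrable lebesgue (\<lambda>x. indicator K x *\<^sub>R g x)"
      using integrable_completion[of "\<lambda>x. indicator K x *\<^sub>R g x" lborel] by auto
    then show "integrable (lebesgue_on K) g"
      using K by (simp add: integrable_restrict_space compact_imp_closed)
  qed
  show ?thesis
    unfolding has_weak_derivative_def
  proof (intro conjI allI impI loc f Gj)
    fix \<phi> assume \<phi>: "test_function \<omega> \<phi>"
    obtain K where K: "compact K" "K \<subseteq> \<omega>" and \<phi>K: "\<And>x. x \<notin> K \<Longrightarrow> \<phi> x = 0"
      and \<phi>'K: "\<And>is x. x \<notin> K \<Longrightarrow> partials is \<phi> x = 0"
      using test_function_support[OF \<phi>] by metis
    define F where "F x = (if x \<in> \<omega> then f x * \<phi> x else 0)" for x
    define E where "E x h = (if x \<in> \<omega> then f x * frechet_derivative \<phi> (at x) h + (G x \<bullet> h) * \<phi> x else 0)" for x h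
    have FE: "(F has_derivative E x) (at x)" for x
    proof (cases "x \<in> \<omega>")
      case True
      have "((\<lambda>x. f x * \<phi> x) has_derivative E x) (at x)"
        using has_derivative_mult[OF D[OF True] smooth_has_derivative[OF test_function_smooth[OF \<phi>]]] True
        by (simp add: E_def[abs_def])
      then show ?thesis
        by (rule has_derivative_transform_within_open[OF _ \<omega> True]) (simp add: F_def)
    next
      case False
      then have "E x = (\<lambda>h. 0)" by (auto simp: E_def)
      moreover have "(F has_derivative (\<lambda>h. 0)) (at x)"
        by (rule has_derivative_transform_within_open[OF has_derivative_const, of "- K"])
          (use False K \<phi>K in \<open>auto simp: F_def compact_imp_closed open_Compl\<close>)
      ultimately show ?thesis by simp
    qed
    define d where "d x = f x * partials [j] \<phi> x + G x $ j * \<phi> x" for x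
    have Ed: "E x (axis j 1) = (if x \<in> \<omega> then d x else 0)" for x
      by (simp add: E_def d_def inner_axis)
    have "continuous_on K d"
      unfolding d_def
      by (intro continuous_on_add continuous_on_mult continuous_on_subset[OF f K(2)]
          continuous_on_subset[OF Gj K(2)] smooth_continuous smooth_partials test_function_smooth[OF \<phi>])
    then have "compact (d ` K)"
      using K(1) by (rule compact_continuous_image)
    then obtain B where B: "\<forall>y\<in>d ` K. norm y \<le> B"
      using compact_imp_bounded bounded_iff by blast
    have d0: "d x = 0" if "x \<notin> K" for x
      using that \<phi>'K[of x "[j]"] by (simp add: d_def \<phi>K del: partials.simps)
    have "\<bar>E x (axis j 1)\<bar> \<le> max B 0" for x
      using B d0[of x] by (cases "x \<in> K") (auto simp: Ed le_max_iff_disj)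
    moreover obtain R where R: "K \<subseteq> cball 0 R"
      using bounded_subset_cball_0[OF compact_imp_bounded[OF K(1)]] .
    have "F x = 0" if "norm x > R" for x
    proof -
      have "x \<notin> K" using R that by force
      then show ?thesis by (simp add: F_def \<phi>K)
    qed
    ultimately have "(\<integral>x. E x (axis j 1) \<partial>lborel) = 0"
      by (intro integral_directional_derivative_zero[OF FE]) auto
    moreover have int: "integrable (lebesgue_on \<omega>) (\<lambda>x. f x * partials [j] \<phi> x)"
      "integrable (lebesgue_on \<omega>) (\<lambda>x. G x $ j * \<phi> x)"
      by (intro locally_integrable_test_integrable[OF \<omega>] loc f Gj \<phi> test_function_partials)+
    then have "d \<in> borel_measurable (lebesgue_on \<omega>)"
      unfolding d_def[abs_def] by (intro borel_measurable_add borel_measurable_integrable)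
    moreover have "(\<lambda>x. E x (axis j 1)) \<in> borel_measurable borel"
    proof -
      have "(\<lambda>x. indicator \<omega> x *\<^sub>R d x) \<in> borel_measurable borel"
        unfolding d_def using \<omega>
        by (intro borel_measurable_continuous_on_indicator continuous_on_add continuous_on_mult f Gj
            smooth_continuous smooth_partials test_function_smooth[OF \<phi>]) auto
      also have "(\<lambda>x. indicator \<omega> x *\<^sub>R d x) = (\<lambda>x. E x (axis j 1))"
        by (auto simp: Ed)
      finally show ?thesis .
    qed
    ultimately have "integral\<^sup>L (lebesgue_on \<omega>) d = 0"
      using \<omega> by (subst lebesgue_on_eq_lborel(1)[where W = "\<lambda>x. E x (axis j 1)"])
        (auto simp: Ed AE_lebesgue_on_iff)
    then show "integral\<^sup>L (lebesgue_on \<omega>) (\<lambda>x. f x * partials [j] \<phi> x)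
        = (- 1) ^ length [j] * integral\<^sup>L (lebesgue_on \<omega>) (\<lambda>x. G x $ j * \<phi> x)"
      using int by (simp add: d_def[abs_def] del: partials.simps)
  qed
qed

section \<open>Isometric surfaces in Sobolev spaces\<close>

lemma sobolev_weak_derivative:
  assumes "sobolev_H k \<omega> u" "length is \<le> k"
  shows "has_weak_derivative \<omega> is u (weak_derivative \<omega> is u)"
  using assms unfolding sobolev_H_def weak_derivative_def by (metis someI_ex)

lemma sobolev_H_mono: "sobolev_H k \<omega> u \<Longrightarrow> l \<le> k \<Longrightarrow> sobolev_H l \<omega> u"
  by (auto simp: sobolev_H_def)

text \<open>
  The functions \<open>grad\<close> and \<open>hess\<close> are arbitrarily chosen weak derivatives. The product rule is applied to
  square integrable ones, which agree with them almost everywhere; hence the formulation up to null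
  sets.
\<close>

lemma metric_weak_derivative:
  fixes \<psi> :: "real^2 \<Rightarrow> real^3"
  assumes \<omega>: "open \<omega>" "bounded \<omega>" and \<psi>: "sobolev_H_vec 2 \<omega> \<psi>"
  shows "\<exists>u v. has_weak_derivative \<omega> [j] u v \<and>
    (AE x in lebesgue_on \<omega>. u x = metric_tensor \<omega> \<psi> x $ i $ k) \<and>
    (AE x in lebesgue_on \<omega>. v x = hess_along (hess \<omega> \<psi> x) (column k (grad \<omega> \<psi> x)) $ i $ j
      + hess_along (hess \<omega> \<psi> x) (column i (grad \<omega> \<psi> x)) $ k $ j)"
proof -
  have H: "sobolev_H 2 \<omega> (\<lambda>y. \<psi> y $ m)" for m
    using \<psi> by (simp add: sobolev_H_vec_def)
  have "\<forall>m i. \<exists>p. has_weak_derivative \<omega> [i] (\<lambda>y. \<psi> y $ m) p \<and> square_integrable_on \<omega> p"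
    using H unfolding sobolev_H_def by (metis length_Cons list.size(3) One_nat_def one_le_numeral)
  then obtain P where P: "\<And>m i. has_weak_derivative \<omega> [i] (\<lambda>y. \<psi> y $ m) (P m i)"
    "\<And>m i. square_integrable_on \<omega> (P m i)" by metis
  have "\<forall>m i j. \<exists>p. has_weak_derivative \<omega> [i, j] (\<lambda>y. \<psi> y $ m) p \<and> square_integrable_on \<omega> p"
    using H unfolding sobolev_H_def by (metis length_Cons list.size(3) numeral_2_eq_2 order_refl)
  then obtain Q where Q: "\<And>m i j. has_weak_derivative \<omega> [i, j] (\<lambda>y. \<psi> y $ m) (Q m i j)"
    "\<And>m i j. square_integrable_on \<omega> (Q m i j)" by metis
  have P_eq: "AE x in lebesgue_on \<omega>. \<forall>m i. P m i x = grad \<omega> \<psi> x $ m $ i"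
  proof -
    have "AE x in lebesgue_on \<omega>. P m i x = weak_derivative \<omega> [i] (\<lambda>y. \<psi> y $ m) x" for m i
      using weak_derivative_unique[OF \<omega>(1) P(1) sobolev_weak_derivative[OF H]] by simp
    then show ?thesis by (simp add: grad_def AE_all_countable)
  qed
  have Q_eq: "AE x in lebesgue_on \<omega>. \<forall>m i j. Q m i j x = hess \<omega> \<psi> x $ m $ i $ j"
  proof -
    have "AE x in lebesgue_on \<omega>. Q m i j x = weak_derivative \<omega> [i, j] (\<lambda>y. \<psi> y $ m) x" for m i j
      using weak_derivative_unique[OF \<omega>(1) Q(1) sobolev_weak_derivative[OF H]] by simp
    then show ?thesis by (simp add: hess_def AE_all_countable)
  qed
  have "has_weak_derivative \<omega> [j] (\<lambda>x. \<Sum>m\<in>UNIV. P m i x * P m k x)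
      (\<lambda>x. \<Sum>m\<in>UNIV. Q m i j x * P m k x + P m i x * Q m k j x)"
    by (intro has_weak_derivative_sum weak_product_rule \<omega> P(2) Q(2)
        has_weak_derivative_iterated[OF P(1) Q(1)])
  moreover have "AE x in lebesgue_on \<omega>. (\<Sum>m\<in>UNIV. P m i x * P m k x) = metric_tensor \<omega> \<psi> x $ i $ k"
    using P_eq by eventually_elim
      (simp add: metric_tensor_def matrix_matrix_mult_def transpose_def)
  moreover have "AE x in lebesgue_on \<omega>. (\<Sum>m\<in>UNIV. Q m i j x * P m k x + P m i x * Q m k j x)
      = hess_along (hess \<omega> \<psi> x) (column k (grad \<omega> \<psi> x)) $ i $ j
      + hess_along (hess \<omega> \<psi> x) (column i (grad \<omega> \<psi> x)) $ k $ j"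
    using P_eq Q_eq by eventually_elim
      (simp add: hess_along_def column_def inner_vec_def sum.distrib mult.commute)
  ultimately show ?thesis by blast
qed

lemma hess_symmetric_AE:
  fixes \<psi> :: "real^2 \<Rightarrow> real^3"
  assumes \<omega>: "open \<omega>" and \<psi>: "sobolev_H_vec 2 \<omega> \<psi>"
  shows "AE x in lebesgue_on \<omega>. \<forall>m i j. hess \<omega> \<psi> x $ m $ i $ j = hess \<omega> \<psi> x $ m $ j $ i"
proof -
  have H: "sobolev_H 2 \<omega> (\<lambda>y. \<psi> y $ m)" for m
    using \<psi> by (simp add: sobolev_H_vec_def)
  have "AE x in lebesgue_on \<omega>. weak_derivative \<omega> [i, j] (\<lambda>y. \<psi> y $ m) x
      = weak_derivative \<omega> [j, i] (\<lambda>y. \<psi> y $ m) x" for m i j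
    by (rule weak_mixed_derivatives_symmetric[OF \<omega> sobolev_weak_derivative[OF H]
          sobolev_weak_derivative[OF H]]) simp_all
  then show ?thesis by (simp add: hess_def AE_all_countable)
qed

text \<open>
  The difference of \<open>T\<close> and \<open>T'\<close> is symmetric in its first two arguments and antisymmetric in the
  first and the last. Composing the two transpositions, a cyclic shift of the arguments changes its
  sign; three shifts are the identity, so the difference equals its own negative. This is the
  computation behind Koszul's formula for the Christoffel symbols.
\<close>

lemma koszul_antisymmetry:
  fixes T T' :: "'i \<Rightarrow> 'i \<Rightarrow> 'i \<Rightarrow> real"
  assumes sym: "\<And>i j k. T i j k = T j i k" "\<And>i j k. T' i j k = T' j i k"
    and metric: "\<And>i j k. T i j k + T k j i = T' i j k + T' k j i"
  shows "T i j k = T' i j k"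
  using metric[of i j k] metric[of j k i] metric[of k i j] sym[of i j k] sym[of j k i] sym[of k i j]
  by linarith

lemma hess_along_symmetric:
  assumes "\<And>m i j. H $ m $ i $ j = H $ m $ j $ i"
  shows "transpose (hess_along H v) = hess_along H v" "hess_along H v $ i $ j = hess_along H v $ j $ i"
  using assms by (simp_all add: hess_along_def transpose_def)

text \<open>
  The weak derivative of \<open>\<partial>\<^sub>i\<psi> \<bullet> \<partial>\<^sub>k\<psi>\<close> in direction \<open>j\<close> is
  \<open>\<partial>\<^sub>i\<partial>\<^sub>j\<psi> \<bullet> \<partial>\<^sub>k\<psi> + \<partial>\<^sub>k\<partial>\<^sub>j\<psi> \<bullet> \<partial>\<^sub>i\<psi>\<close>. Equal metrics have equal weak derivatives, and with the symmetry of the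
  Hessian these sums determine their individual terms.
\<close>

lemma isometric_tangential_hessian_AE:
  fixes \<psi>A \<psi>B :: "real^2 \<Rightarrow> real^3"
  assumes \<omega>: "open \<omega>" "bounded \<omega>" and A: "sobolev_H_vec 2 \<omega> \<psi>A" and B: "sobolev_H_vec 2 \<omega> \<psi>B"
    and iso: "AE x in lebesgue_on \<omega>. metric_tensor \<omega> \<psi>B x = metric_tensor \<omega> \<psi>A x"
  shows "AE x in lebesgue_on \<omega>. \<forall>k. hess_along (hess \<omega> \<psi>B x) (column k (grad \<omega> \<psi>B x))
    = hess_along (hess \<omega> \<psi>A x) (column k (grad \<omega> \<psi>A x))"
proof -
  define T where "T \<psi> i j k x = hess_along (hess \<omega> \<psi> x) (column k (grad \<omega> \<psi> x)) $ i $ j"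
    for \<psi> :: "real^2 \<Rightarrow> real^3" and i j k x
  have "AE x in lebesgue_on \<omega>. T \<psi>B i j k x + T \<psi>B k j i x = T \<psi>A i j k x + T \<psi>A k j i x" for i j k
  proof -
    obtain u v where uv: "has_weak_derivative \<omega> [j] u v"
      "AE x in lebesgue_on \<omega>. u x = metric_tensor \<omega> \<psi>A x $ i $ k"
      "AE x in lebesgue_on \<omega>. v x = T \<psi>A i j k x + T \<psi>A k j i x"
      using metric_weak_derivative[OF \<omega> A, of j i k] unfolding T_def by blast
    obtain u' v' where uv': "has_weak_derivative \<omega> [j] u' v'"
      "AE x in lebesgue_on \<omega>. u' x = metric_tensor \<omega> \<psi>B x $ i $ k"
      "AE x in lebesgue_on \<omega>. v' x = T \<psi>B i j k x + T \<psi>B k j i x"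
      using metric_weak_derivative[OF \<omega> B, of j i k] unfolding T_def by blast
    have "AE x in lebesgue_on \<omega>. u' x = u x"
      using uv(2) uv'(2) iso by eventually_elim simp
    then have "AE x in lebesgue_on \<omega>. v' x = v x"
      by (rule weak_derivative_unique[OF \<omega>(1) uv'(1) uv(1)])
    then show ?thesis
      using uv(3) uv'(3) by eventually_elim simp
  qed
  then have "AE x in lebesgue_on \<omega>. \<forall>i j k. T \<psi>B i j k x + T \<psi>B k j i x = T \<psi>A i j k x + T \<psi>A k j i x"
    by (simp add: AE_all_countable)
  with hess_symmetric_AE[OF \<omega>(1) A] hess_symmetric_AE[OF \<omega>(1) B] show ?thesis
  proof eventually_elim
    case (elim x)
    have "T \<psi>B i j k x = T \<psi>A i j k x" for i j k
    proof (rule koszul_antisymmetry[where T = "\<lambda>i j k. T \<psi>B i j k x" and T' = "\<lambda>i j k. T \<psi>A i j k x"])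
      show "T \<psi>B i j k x = T \<psi>B j i k x" "T \<psi>A i j k x = T \<psi>A j i k x" for i j k
        unfolding T_def using elim(1,2) by (auto intro: hess_along_symmetric(2))
    qed (use elim(3) in blast)
    then show ?case
      by (simp add: T_def vec_eq_iff)
  qed
qed

lemma regular_metric_AE:
  fixes \<psi> :: "real^2 \<Rightarrow> real^3"
  assumes \<omega>: "open \<omega>" and \<psi>: "sobolev_H_vec 2 \<omega> \<psi>" and reg: "injective_regular_parametrization \<omega> \<psi>"
  shows "AE x in lebesgue_on \<omega>. sym_pos_def (metric_tensor \<omega> \<psi> x)"
proof -
  obtain G :: "real^2 \<Rightarrow> real^2^3" where G: "continuous_on (closure \<omega>) G"
    "\<And>x. x \<in> \<omega> \<Longrightarrow> (\<psi> has_derivative (\<lambda>h. G x *v h)) (at x)" "\<And>x. x \<in> closure \<omega> \<Longrightarrow> rank (G x) = 2"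
    using reg by (auto simp: injective_regular_parametrization_def)
  have H: "sobolev_H 2 \<omega> (\<lambda>y. \<psi> y $ m)" for m
    using \<psi> by (simp add: sobolev_H_vec_def)
  have "AE x in lebesgue_on \<omega>. weak_derivative \<omega> [i] (\<lambda>y. \<psi> y $ m) x = G x $ m $ i" for m i
  proof (rule weak_derivative_unique[OF \<omega>])
    show "has_weak_derivative \<omega> [i] (\<lambda>y. \<psi> y $ m) (weak_derivative \<omega> [i] (\<lambda>y. \<psi> y $ m))"
      by (rule sobolev_weak_derivative[OF H]) simp
    show "has_weak_derivative \<omega> [i] (\<lambda>y. \<psi> y $ m) (\<lambda>x. G x $ m $ i)"
    proof (rule continuously_differentiable_has_weak_derivative[OF \<omega>, where G = "\<lambda>x. G x $ m"])
      show "((\<lambda>y. \<psi> y $ m) has_derivative (\<lambda>h. G x $ m \<bullet> h)) (at x)" if "x \<in> \<omega>" for x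
        using bounded_linear.has_derivative[OF bounded_linear_vec_nth G(2)[OF that], of m]
        by (simp add: matrix_vector_mul_component)
      show "continuous_on \<omega> (\<lambda>x. G x $ m)"
        by (intro continuous_intros continuous_on_subset[OF G(1) closure_subset])
    qed
  qed simp
  then have "AE x in lebesgue_on \<omega>. \<forall>m i. grad \<omega> \<psi> x $ m $ i = G x $ m $ i"
    by (simp add: grad_def AE_all_countable)
  moreover have "AE x in lebesgue_on \<omega>. x \<in> \<omega>"
    by (rule AE_I2) simp
  ultimately show ?thesis
  proof eventually_elim
    case (elim x)
    then have "grad \<omega> \<psi> x = G x" by (simp add: vec_eq_iff)
    then show ?case
      using sym_pos_def_gram[OF G(3)[of x]] elim(2) closure_subset[of \<omega>]
      by (auto simp: metric_tensor_def)
  qed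
qed

section \<open>The bending energy of an isometric deformation\<close>

lemma second_form_eq: "second_form \<omega> \<psi> x = - hess_along (hess \<omega> \<psi> x) (normal_of (grad \<omega> \<psi> x))"
  by (simp add: second_form_def hess_dot_normal_def hess_along_def unit_normal_def normal_of_def)

lemma conjugate_uminus: "A ** (- X) ** B = - (A ** X ** B)"
  for A :: "real^'n^'m" and X :: "real^'k^'n" and B :: "real^'l^'k"
  by (simp add: matrix_matrix_mult_def vec_eq_iff sum_negf)

lemma conjugate_diff: "A ** (X - Y) ** B = A ** X ** B - A ** Y ** B"
  for A :: "real^'n^'m" and X Y :: "real^'k^'n" and B :: "real^'l^'k"
  by (simp add: matrix_matrix_mult_def vec_eq_iff sum_subtractf algebra_simps)

text \<open>
  One copy of the squared norm is \<open>|R ** II\<^sub>A ** R|\<^sup>2\<close> from the expanded square. The other one, together with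
  the subtracted sum, is minus the tangential energy of the Hessian, which \<open>\<psi>A\<close> shares with \<open>\<psi>B\<close>.
\<close>

definition bending_constant :: "real^2^3 \<Rightarrow> real^2^2^3 \<Rightarrow> real" where
  "bending_constant P H = (let R = spd_sqrt (matrix_inv (transpose P ** P)) in
     2 * (norm (R ** hess_along H (normal_of P) ** R))\<^sup>2 - (\<Sum>m\<in>UNIV. (norm (R ** (H $ m) ** R))\<^sup>2))"

text \<open>
  The whole algebra at a point, for Jacobians \<open>P\<close> and \<open>Q\<close> with the same Gram matrix and Hessians with the
  same tangential components.
\<close>

lemma relative_bending_pointwise:
  fixes P Q :: "real^2^3" and HA HB :: "real^2^2^3"
  defines "g \<equiv> transpose P ** P"
  defines "R \<equiv> spd_sqrt (matrix_inv g)"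
  defines "IIA \<equiv> - hess_along HA (normal_of P)" and "IIB \<equiv> - hess_along HB (normal_of Q)"
  assumes pd: "sym_pos_def g" and iso: "transpose Q ** Q = g"
    and sym: "\<And>m i j. HA $ m $ i $ j = HA $ m $ j $ i" "\<And>m i j. HB $ m $ i $ j = HB $ m $ j $ i"
    and tang: "\<And>k. hess_along HB (column k Q) = hess_along HA (column k P)"
  shows "trace ((matrix_inv g ** (IIA - IIB)) ** (matrix_inv g ** (IIA - IIB)))
      = (norm (R ** (IIB - IIA) ** R))\<^sup>2"
    and "(norm (R ** (IIB - IIA) ** R))\<^sup>2
      = (\<Sum>m\<in>UNIV. (norm (R ** (HB $ m) ** R))\<^sup>2)
        - 2 * (IIB \<bullet> (matrix_inv g ** IIA ** matrix_inv g)) + bending_constant P HA"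
proof -
  note R_sqrt = spd_sqrt_2[OF sym_pos_def_inverse[OF pd], folded R_def]
  have RT: "transpose R = R" and RR: "matrix_inv g = R ** R"
    using R_sqrt by (simp_all add: sym_pos_def_def)
  have "transpose (IIA - IIB) = IIA - IIB"
    unfolding IIA_def IIB_def using hess_along_symmetric(2)[OF sym(1)] hess_along_symmetric(2)[OF sym(2)]
    by (simp add: transpose_def vec_eq_iff)
  then have "trace ((matrix_inv g ** (IIA - IIB)) ** (matrix_inv g ** (IIA - IIB)))
      = (norm (R ** (IIA - IIB) ** R))\<^sup>2"
    unfolding RR by (rule trace_square_eq_norm_conjugate[OF RT])
  also have "\<dots> = (norm (R ** (IIB - IIA) ** R))\<^sup>2"
    unfolding conjugate_diff by (simp add: norm_minus_commute)
  finally show "trace ((matrix_inv g ** (IIA - IIB)) ** (matrix_inv g ** (IIA - IIB)))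
      = (norm (R ** (IIB - IIA) ** R))\<^sup>2" .
  have "0 < det g" using pd by (simp add: sym_pos_def_2_iff)
  then have c: "cross3 (column 1 P) (column 2 P) \<noteq> 0"
    by (auto simp: g_def gram_det)
  have normal: "(norm (R ** IIB ** R))\<^sup>2
      = (\<Sum>m\<in>UNIV. (norm (R ** (HB $ m) ** R))\<^sup>2) + (norm (R ** IIA ** R))\<^sup>2
        - (\<Sum>m\<in>UNIV. (norm (R ** (HA $ m) ** R))\<^sup>2)"
    using tangential_hessian_energy_eq[OF iso[unfolded g_def] tang c, of R]
    by (simp add: IIA_def IIB_def conjugate_uminus)
  have "(norm (R ** (IIB - IIA) ** R))\<^sup>2
      = (norm (R ** IIB ** R))\<^sup>2 - 2 * ((R ** IIB ** R) \<bullet> (R ** IIA ** R)) + (norm (R ** IIA ** R))\<^sup>2"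
    unfolding conjugate_diff
    by (simp add: power2_norm_eq_inner inner_diff_left inner_diff_right inner_commute)
  also have "(R ** IIB ** R) \<bullet> (R ** IIA ** R) = IIB \<bullet> (matrix_inv g ** IIA ** matrix_inv g)"
    unfolding RR by (rule inner_conjugate_symmetric[OF RT])
  finally show "(norm (R ** (IIB - IIA) ** R))\<^sup>2
      = (\<Sum>m\<in>UNIV. (norm (R ** (HB $ m) ** R))\<^sup>2)
        - 2 * (IIB \<bullet> (matrix_inv g ** IIA ** matrix_inv g)) + bending_constant P HA"
    unfolding normal bending_constant_def
    by (simp add: R_def g_def IIA_def conjugate_uminus Let_def)
qed

theorem proposition2p1:
  shows "\<exists>F :: real^2^3 \<Rightarrow> real^2^2^3 \<Rightarrow> real.
    \<forall>(\<omega> :: (real^2) set) (\<psi>A :: real^2 \<Rightarrow> real^3).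
      bounded_connected_lipschitz_domain \<omega> \<and> sobolev_H_vec 3 \<omega> \<psi>A \<and>
      injective_regular_parametrization \<omega> \<psi>A \<longrightarrow>
      (\<exists>C\<^sub>A :: real^2 \<Rightarrow> real.
        (\<forall>x\<in>\<omega>. C\<^sub>A x = F (grad \<omega> \<psi>A x) (hess \<omega> \<psi>A x)) \<and>
        (\<forall>\<psi>B :: real^2 \<Rightarrow> real^3.
          sobolev_H_vec 2 \<omega> \<psi>B \<and>
          (AE x in lebesgue_on \<omega>. metric_tensor \<omega> \<psi>B x = metric_tensor \<omega> \<psi>A x) \<longrightarrow>
          (AE x in lebesgue_on \<omega>.
            trace (rel_shape_operator \<omega> \<psi>A \<psi>B x ** rel_shape_operator \<omega> \<psi>A \<psi>B x)
              = (norm (inv_sqrt_metric \<omega> \<psi>A x ** (second_form \<omega> \<psi>B x - second_form \<omega> \<psi>A x)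
                   ** inv_sqrt_metric \<omega> \<psi>A x))\<^sup>2 \<and>
            (norm (inv_sqrt_metric \<omega> \<psi>A x ** (second_form \<omega> \<psi>B x - second_form \<omega> \<psi>A x)
                   ** inv_sqrt_metric \<omega> \<psi>A x))\<^sup>2
              = B_functional \<omega> \<psi>A C\<^sub>A \<psi>B x)))"
proof (intro exI[of _ bending_constant] allI impI)
  fix \<omega> :: "(real^2) set" and \<psi>A :: "real^2 \<Rightarrow> real^3"
  assume hyp: "bounded_connected_lipschitz_domain \<omega> \<and> sobolev_H_vec 3 \<omega> \<psi>A \<and>
      injective_regular_parametrization \<omega> \<psi>A"
  then have \<omega>: "open \<omega>" "bounded \<omega>"
    by (auto simp: bounded_connected_lipschitz_domain_def)
  have A: "sobolev_H_vec 2 \<omega> \<psi>A"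
    using hyp sobolev_H_mono[of 3 \<omega> _ 2] by (auto simp: sobolev_H_vec_def)
  define C where "C x = bending_constant (grad \<omega> \<psi>A x) (hess \<omega> \<psi>A x)" for x
  have main: "AE x in lebesgue_on \<omega>.
            trace (rel_shape_operator \<omega> \<psi>A \<psi>B x ** rel_shape_operator \<omega> \<psi>A \<psi>B x)
              = (norm (inv_sqrt_metric \<omega> \<psi>A x ** (second_form \<omega> \<psi>B x - second_form \<omega> \<psi>A x)
                   ** inv_sqrt_metric \<omega> \<psi>A x))\<^sup>2 \<and>
            (norm (inv_sqrt_metric \<omega> \<psi>A x ** (second_form \<omega> \<psi>B x - second_form \<omega> \<psi>A x)
                   ** inv_sqrt_metric \<omega> \<psi>A x))\<^sup>2
              = B_functional \<omega> \<psi>A C \<psi>B x"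
    if B: "sobolev_H_vec 2 \<omega> \<psi>B"
      and iso: "AE x in lebesgue_on \<omega>. metric_tensor \<omega> \<psi>B x = metric_tensor \<omega> \<psi>A x" for \<psi>B
    using isometric_tangential_hessian_AE[OF \<omega> A B iso] hess_symmetric_AE[OF \<omega>(1) A]
      hess_symmetric_AE[OF \<omega>(1) B] regular_metric_AE[OF \<omega>(1) A hyp[THEN conjunct2, THEN conjunct2]] iso
  proof eventually_elim
    case (elim x)
    have eqs: "inv_sqrt_metric \<omega> \<psi>A x = spd_sqrt (matrix_inv (transpose (grad \<omega> \<psi>A x) ** grad \<omega> \<psi>A x))"
      "inv_metric_tensor \<omega> \<psi>A x = matrix_inv (transpose (grad \<omega> \<psi>A x) ** grad \<omega> \<psi>A x)"
      by (simp_all add: inv_sqrt_metric_def inv_metric_tensor_def metric_tensor_def)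
    show ?case
      unfolding B_functional_def rel_shape_operator_def second_form_eq eqs C_def
      by (intro conjI relative_bending_pointwise)
        (use elim in \<open>auto simp: metric_tensor_def\<close>)
  qed
  show "\<exists>C\<^sub>A :: real^2 \<Rightarrow> real.
        (\<forall>x\<in>\<omega>. C\<^sub>A x = bending_constant (grad \<omega> \<psi>A x) (hess \<omega> \<psi>A x)) \<and>
        (\<forall>\<psi>B :: real^2 \<Rightarrow> real^3.
          sobolev_H_vec 2 \<omega> \<psi>B \<and>
          (AE x in lebesgue_on \<omega>. metric_tensor \<omega> \<psi>B x = metric_tensor \<omega> \<psi>A x) \<longrightarrow>
          (AE x in lebesgue_on \<omega>.
            trace (rel_shape_operator \<omega> \<psi>A \<psi>B x ** rel_shape_operator \<omega> \<psi>A \<psi>B x)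
              = (norm (inv_sqrt_metric \<omega> \<psi>A x ** (second_form \<omega> \<psi>B x - second_form \<omega> \<psi>A x)
                   ** inv_sqrt_metric \<omega> \<psi>A x))\<^sup>2 \<and>
            (norm (inv_sqrt_metric \<omega> \<psi>A x ** (second_form \<omega> \<psi>B x - second_form \<omega> \<psi>A x)
                   ** inv_sqrt_metric \<omega> \<psi>A x))\<^sup>2
              = B_functional \<omega> \<psi>A C\<^sub>A \<psi>B x))"
    using main by (intro exI[of _ C]) (simp add: C_def)
qed

end
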